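(* Let $\Lambda$ be a finite set of sites and $N\ge2$. For each unordered pair $\langle xy\rangle$ of distinct sites let $J'_{xy},K'_{xy},J_{xy},K_{xy}\in\mathbb{R}$ satisfy $$\begin{cases}|J'_{xy}| & \text{if } |K'_{xy}|\le|J'_{xy}|\\ \tfrac14|K'_{xy}|\big(1+\tfrac{|J'_{xy}|}{|K'_{xy}|}\big)^2 & \text{if } |K'_{xy}|>|J'_{xy}|\end{cases}\ \le J_{xy}\qquad\text{and}\qquad \tfrac14|K'_{xy}|\le K_{xy}.$$ Let $\langle\cdot\rangle_{N,J',K'}$ be expectation in the $N$-component mixed isovector/isotensor model: spins $\sigma_x\in S^{N-1}\subset\mathbb{R}^N$, measure proportional to $\exp\{\sum_{\langle xy\rangle}[J'_{xy}\sigma_x\cdot\sigma_y+\tfrac12K'_{xy}(\sigma_x\cdot\sigma_y)^2]\}\prod_x d\Omega(\sigma_x)$, with $d\Omega$ uniform measure on $S^{N-1}$. Let $\langle\cdot\rangle_{XY,J,K}$ be expectation in the generalized $XY$ model: angles $\theta_x\in[0,2\pi)$, measure proportional to $\exp\{\sum_{\langle xy\rangle}[J_{xy}\cos(\theta_x-\theta_y)+K_{xy}\cos2(\theta_x-\theta_y)]\}\prod_x d\theta_x$. Then for all $x,y\in\Lambda$, $$|\langle\sigma_x\cdot\sigma_y\rangle_{N,J',K'}|\le\langle\cos(\theta_x-\theta_y)\rangle_{XY,J,K},$$ and, writing $\gamma_{xy}=\langle\cos2(\theta_x-\theta_y)\rangle_{XY,J,K}$, $$0\le\langle(\sigma_x\cdot\sigma_y)^2\rangle_{N,J',K'}\le\frac1N+\frac{(N-1)(N+2)}{N\,[2N-(N-2)\gamma_{xy}]}\gamma_{xy}\le\frac1N+\Big(1-\frac1N\Big)\gamma_{xy}.$$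 *)

theory Defs
  imports "HOL-Probability.Probability"
begin

text \<open>Normalized uniform (rotation invariant) probability measure on the unit sphere
  S^{N-1} of real^'n (N = CARD('n)), defined as the cone measure: the push-forward of
  the uniform probability measure on the unit ball under radial projection.\<close>
definition unif_sphere :: "(real^'n) measure" where
  "unif_sphere = distr (uniform_measure lborel (ball 0 1)) borel (\<lambda>v. v /\<^sub>R norm v)"

text \<open>Sum over unordered pairs of distinct sites of a symmetric bond function g,
  written as half the sum over ordered pairs.\<close>
definition bond_sum :: "'a set \<Rightarrow> ('a \<Rightarrow> 'a \<Rightarrow> real) \<Rightarrow> real" where
  "bond_sum \<Lambda> g = (\<Sum>(x,y)\<in>{(x,y). x \<in> \<Lambda> \<and> y \<in> \<Lambda> \<and> x \<noteq> y}. g x y) / 2"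

definition gibbs_expect :: "'b measure \<Rightarrow> ('b \<Rightarrow> real) \<Rightarrow> ('b \<Rightarrow> real) \<Rightarrow> real" where
  "gibbs_expect M H f = (\<integral>\<omega>. f \<omega> * exp (H \<omega>) \<partial>M) / (\<integral>\<omega>. exp (H \<omega>) \<partial>M)"

definition H_iso :: "'a set \<Rightarrow> ('a set \<Rightarrow> real) \<Rightarrow> ('a set \<Rightarrow> real) \<Rightarrow> ('a \<Rightarrow> real^'n) \<Rightarrow> real" where
  "H_iso \<Lambda> J' K' \<sigma> = bond_sum \<Lambda> (\<lambda>x y. J' {x,y} * (\<sigma> x \<bullet> \<sigma> y) + K' {x,y} / 2 * (\<sigma> x \<bullet> \<sigma> y)^2)"

definition expect_N :: "'a set \<Rightarrow> ('a set \<Rightarrow> real) \<Rightarrow> ('a set \<Rightarrow> real) \<Rightarrow> (('a \<Rightarrow> real^'n) \<Rightarrow> real) \<Rightarrow> real" where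
  "expect_N \<Lambda> J' K' f = gibbs_expect (PiM \<Lambda> (\<lambda>_. unif_sphere)) (H_iso \<Lambda> J' K') f"

definition H_XY :: "'a set \<Rightarrow> ('a set \<Rightarrow> real) \<Rightarrow> ('a set \<Rightarrow> real) \<Rightarrow> ('a \<Rightarrow> real) \<Rightarrow> real" where
  "H_XY \<Lambda> J K \<theta> = bond_sum \<Lambda> (\<lambda>x y. J {x,y} * cos (\<theta> x - \<theta> y) + K {x,y} * cos (2 * (\<theta> x - \<theta> y)))"

definition expect_XY :: "'a set \<Rightarrow> ('a set \<Rightarrow> real) \<Rightarrow> ('a set \<Rightarrow> real) \<Rightarrow> (('a \<Rightarrow> real) \<Rightarrow> real) \<Rightarrow> real" where
  "expect_XY \<Lambda> J K f = gibbs_expect (PiM \<Lambda> (\<lambda>_. restrict_space lborel {0..<2*pi})) (H_XY \<Lambda> J K) f"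

end

theory Submission
  imports Defs
begin

text \<open>Fix a coordinate plane and rotate every spin independently in this plane, which leaves the product
  of the sphere measures invariant. Conditionally on the lengths \<open>r\<^sub>x\<close> of the planar parts and on the
  remaining components, with inner products \<open>s\<^sub>x\<^sub>y\<close>, the angles form a generalized \<open>XY\<close> model with couplings
  \<open>r\<^sub>x r\<^sub>y (J' + K' s\<^sub>x\<^sub>y)\<close> and \<open>K' r\<^sub>x\<^sup>2 r\<^sub>y\<^sup>2 / 4\<close>. Since \<open>\<bar>s\<^sub>x\<^sub>y\<bar> + r\<^sub>x r\<^sub>y \<le> 1\<close>, maximizing over \<open>r\<^sub>x r\<^sub>y\<close> bounds them by
  \<open>J\<close> and \<open>K\<close>, so Ginibre's inequality bounds the conditional correlation of \<open>cos m(\<theta>\<^sub>x - \<theta>\<^sub>y)\<close> by that of the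
  model with couplings \<open>J, K\<close>. Summing over all coordinate planes gives a linear relation between the
  isotropic moments, where a rotation of all spins by \<open>\<pi>/4\<close> eliminates \<open>\<Sum>\<^sub>a (\<sigma>\<^sub>x\<^sup>a \<sigma>\<^sub>y\<^sup>a)\<^sup>2\<close>.\<close>

section \<open>Uniform measure on the torus\<close>

text \<open>The sphere measure is never disintegrated. Conditioning is replaced by averaging over
  orbits of the rotations: for each fixed family of angles the spin measure is preserved, so an
  inequality valid on almost every orbit integrates to
  \<open>|I(corr)| <= \<gamma> * I(size)\<close>. Here size is corr without its angular factor, and
  both sides carry the same Gibbs weight. What is left is to evaluate or bound the size moments. For
  the tensor case let M be the mean of the squared inner product and Q the mean of the
  basis-dependent sum over \<open>a\<close>. The turn by \<pi>/4 yields (N + 2) Q = 2 M + 1, the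
  comparison reads Q (2 N - (N - 2) \<gamma>) \<le> 2 + \<gamma>, and substituting the former into
  the latter produces the stated constant. Translating an angle is a symmetry of the circle but
  moves points out of the interval [0, 2 \<pi>). For this reason the integrands are rewritten as
  functions of \<open>cis (\<theta> x)\<close> wherever angles are changed.\<close>

lemma (in product_sigma_finite) distr_PiM_componentwise:
  assumes I: "finite I"
    and f: "\<And>i. i \<in> I \<Longrightarrow> f i \<in> measurable (M i) (N i)"
    and N: "product_sigma_finite N" "\<And>i. i \<in> I \<Longrightarrow> distr (M i) (N i) (f i) = N i"
  shows "distr (PiM I M) (PiM I N) (\<lambda>\<omega>. \<lambda>i\<in>I. f i (\<omega> i)) = PiM I N"
proof -
  interpret N: product_sigma_finite N by fact
  have m [measurable]: "(\<lambda>\<omega>. \<lambda>i\<in>I. f i (\<omega> i)) \<in> measurable (PiM I M) (PiM I N)"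
    by (intro measurable_restrict measurable_compose[OF measurable_component_singleton] f)
  show ?thesis
  proof (rule N.PiM_eqI[OF I])
    fix A assume A: "\<And>i. i \<in> I \<Longrightarrow> A i \<in> sets (N i)"
    have "(\<lambda>\<omega>. \<lambda>i\<in>I. f i (\<omega> i)) -` Pi\<^sub>E I A \<inter> space (PiM I M) = Pi\<^sub>E I (\<lambda>i. f i -` A i \<inter> space (M i))"
      by (auto simp: space_PiM PiE_iff)
    then have "emeasure (distr (PiM I M) (PiM I N) (\<lambda>\<omega>. \<lambda>i\<in>I. f i (\<omega> i))) (Pi\<^sub>E I A)
      = emeasure (PiM I M) (Pi\<^sub>E I (\<lambda>i. f i -` A i \<inter> space (M i)))"
      using A by (subst emeasure_distr[OF m]) (auto intro!: sets_PiM_I_finite I)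
    also have "\<dots> = (\<Prod>i\<in>I. emeasure (M i) (f i -` A i \<inter> space (M i)))"
      using A f by (intro emeasure_PiM I measurable_sets) auto
    also have "\<dots> = (\<Prod>i\<in>I. emeasure (N i) (A i))"
    proof (rule prod.cong[OF refl])
      fix i assume i: "i \<in> I"
      show "emeasure (M i) (f i -` A i \<inter> space (M i)) = emeasure (N i) (A i)"
        using emeasure_distr[OF f[OF i] A[OF i]] N(2)[OF i] by simp
    qed
    finally show "emeasure (distr (PiM I M) (PiM I N) (\<lambda>\<omega>. \<lambda>i\<in>I. f i (\<omega> i))) (Pi\<^sub>E I A) = (\<Prod>i\<in>I. emeasure (N i) (A i))" .
  qed simp
qed

section \<open>One period of the real line and its image on the circle\<close>

abbreviation circ :: "real measure" where
  "circ \<equiv> restrict_space lborel {0..<2*pi}"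

text \<open>Unnormalized, of total mass \<open>2*pi\<close>, to match \<open>circ\<close>. Equality
  with this measure expresses that a map of the angle preserves the uniform measure modulo the
  period.\<close>

definition circle_measure :: "complex measure" where
  "circle_measure = distr circ borel cis"

lemma borel_measurable_cis [measurable]: "cis \<in> borel_measurable borel"
  by (intro borel_measurable_continuous_onI continuous_intros)

lemma measurable_circ: "f \<in> borel_measurable borel \<Longrightarrow> f \<in> measurable circ borel"
  by (intro measurable_restrict_space1) simp

lemma nn_integral_circ:
  "(\<integral>\<^sup>+t. f t \<partial>circ) = (\<integral>\<^sup>+t. f t * indicator {0..<2*pi} t \<partial>lborel)"
  by (subst nn_integral_restrict_space) auto

lemma nn_integral_lborel_shift:
  fixes f :: "'a::euclidean_space \<Rightarrow> ennreal"
  assumes [measurable]: "f \<in> borel_measurable borel"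
  shows "(\<integral>\<^sup>+t. f (t + a) \<partial>lborel) = (\<integral>\<^sup>+t. f t \<partial>lborel)"
proof -
  have "(\<integral>\<^sup>+t. f t \<partial>lborel) = (\<integral>\<^sup>+t. f t \<partial>distr lborel borel ((+) a))"
    by (simp add: lborel_distr_plus)
  also have "\<dots> = (\<integral>\<^sup>+t. f (t + a) \<partial>lborel)"
    by (subst nn_integral_distr) (auto simp: add.commute)
  finally show ?thesis by simp
qed

lemma nn_integral_periodic_shift:
  fixes h :: "real \<Rightarrow> ennreal"
  assumes [measurable]: "h \<in> borel_measurable borel"
    and per: "\<And>t. h (t + 2*pi) = h t"
  shows "(\<integral>\<^sup>+t. h t * indicator {a..<a+2*pi} t \<partial>lborel) = (\<integral>\<^sup>+t. h t * indicator {0..<2*pi} t \<partial>lborel)"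
proof -
  \<comment> \<open>\<open>c\<close> is the first multiple of the period strictly above
    \<open>a\<close>, so it cuts the window in two. The left piece, moved by one period, completes
    the right one to \<open>{c..<c+2*pi}\<close>, which a translation by \<open>c\<close> relates to
    the standard period.\<close>
  define n where "n = \<lfloor>a / (2*pi)\<rfloor> + 1"
  define c where "c = 2 * pi * of_int n"
  have "2 * pi * of_int \<lfloor>a / (2*pi)\<rfloor> \<le> a" "a < 2 * pi * (of_int \<lfloor>a / (2*pi)\<rfloor> + 1)"
    using floor_divide_lower[of "2*pi" a] floor_divide_upper[of "2*pi" a] by (simp_all add: mult.commute)
  then have c: "a < c" "c \<le> a + 2*pi"
    by (simp_all add: c_def n_def algebra_simps)
  have pern: "h (t + c) = h t" for t
  proof -
    have nat: "h (t + 2*pi*real k) = h t" for t k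
    proof (induction k)
      case (Suc k)
      then show ?case using per[of "t + 2*pi*real k"] by (simp add: algebra_simps)
    qed simp
    show ?thesis
    proof (cases "n \<ge> 0")
      case True then show ?thesis using nat[of t "nat n"] by (simp add: c_def)
    next
      case False then show ?thesis using nat[of "t + c" "nat (-n)"] by (simp add: c_def)
    qed
  qed
  have "(\<integral>\<^sup>+t. h t * indicator {a..<a+2*pi} t \<partial>lborel)
      = (\<integral>\<^sup>+t. h t * indicator {a..<c} t + h t * indicator {c..<a+2*pi} t \<partial>lborel)"
    using c by (intro nn_integral_cong) (auto simp: indicator_def)
  also have "\<dots> = (\<integral>\<^sup>+t. h t * indicator {a..<c} t \<partial>lborel) + (\<integral>\<^sup>+t. h t * indicator {c..<a+2*pi} t \<partial>lborel)"
    by (rule nn_integral_add) auto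
  also have "(\<integral>\<^sup>+t. h t * indicator {a..<c} t \<partial>lborel) = (\<integral>\<^sup>+t. h t * indicator {a+2*pi..<c+2*pi} t \<partial>lborel)"
    by (subst nn_integral_lborel_shift[of "\<lambda>t. h t * indicator {a+2*pi..<c+2*pi} t" "2*pi", symmetric])
       (auto simp: per indicator_def intro!: nn_integral_cong)
  also have "\<dots> + (\<integral>\<^sup>+t. h t * indicator {c..<a+2*pi} t \<partial>lborel)
      = (\<integral>\<^sup>+t. h t * indicator {a+2*pi..<c+2*pi} t + h t * indicator {c..<a+2*pi} t \<partial>lborel)"
    by (rule nn_integral_add[symmetric]) auto
  also have "\<dots> = (\<integral>\<^sup>+t. h t * indicator {c..<c+2*pi} t \<partial>lborel)"
    using c by (intro nn_integral_cong) (auto simp: indicator_def)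
  also have "\<dots> = (\<integral>\<^sup>+t. h t * indicator {0..<2*pi} t \<partial>lborel)"
    by (subst nn_integral_lborel_shift[of "\<lambda>t. h t * indicator {c..<c+2*pi} t" "c", symmetric])
       (auto simp: pern indicator_def intro!: nn_integral_cong)
  finally show ?thesis .
qed

lemma nn_integral_circ_shift:
  fixes h :: "real \<Rightarrow> ennreal"
  assumes [measurable]: "h \<in> borel_measurable borel"
    and per: "\<And>t. h (t + 2*pi) = h t"
  shows "(\<integral>\<^sup>+t. h (t + a) \<partial>circ) = (\<integral>\<^sup>+t. h t \<partial>circ)"
proof -
  have "(\<integral>\<^sup>+t. h (t + a) \<partial>circ) = (\<integral>\<^sup>+t. h (t + a) * indicator {a..<a+2*pi} (t + a) \<partial>lborel)"
    unfolding nn_integral_circ by (intro nn_integral_cong) (auto simp: indicator_def)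
  also have "\<dots> = (\<integral>\<^sup>+t. h t * indicator {a..<a+2*pi} t \<partial>lborel)"
    by (rule nn_integral_lborel_shift[of "\<lambda>t. h t * indicator {a..<a+2*pi} t"]) auto
  also have "\<dots> = (\<integral>\<^sup>+t. h t \<partial>circ)"
    unfolding nn_integral_circ by (rule nn_integral_periodic_shift) (use per in auto)
  finally show ?thesis .
qed

text \<open>Doubling wraps the circle twice at half the density. The calculation is done for twice
  the integral, so that the Jacobian of the substitution appears as a factor and not as a quotient
  in \<open>ennreal\<close>.\<close>

lemma nn_integral_circ_double:
  fixes h :: "real \<Rightarrow> ennreal"
  assumes [measurable]: "h \<in> borel_measurable borel"
    and per: "\<And>t. h (t + 2*pi) = h t"
  shows "(\<integral>\<^sup>+t. h (2 * t) \<partial>circ) = (\<integral>\<^sup>+t. h t \<partial>circ)"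
proof -
  let ?I = "\<integral>\<^sup>+t. h t \<partial>circ"
  have shift: "(\<integral>\<^sup>+t. h t * indicator {2*pi..<2*pi+2*pi} t \<partial>lborel) = ?I"
    unfolding nn_integral_circ by (rule nn_integral_periodic_shift) (use per in auto)
  have "2 * (\<integral>\<^sup>+t. h (2 * t) \<partial>circ) = 2 * (\<integral>\<^sup>+t. h (2*t) * indicator {0..<4*pi} (2*t) \<partial>lborel)"
    unfolding nn_integral_circ by (intro arg_cong[where f="(*) 2"] nn_integral_cong) (auto simp: indicator_def)
  also have "\<dots> = (\<integral>\<^sup>+t. h t * indicator {0..<4*pi} t \<partial>lborel)"
    by (subst (2) nn_integral_real_affine[where c=2 and t=0]) auto
  also have "\<dots> = (\<integral>\<^sup>+t. h t * indicator {0..<2*pi} t + h t * indicator {2*pi..<2*pi+2*pi} t \<partial>lborel)"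
    by (intro nn_integral_cong) (auto simp: indicator_def)
  also have "\<dots> = (\<integral>\<^sup>+t. h t * indicator {0..<2*pi} t \<partial>lborel) + (\<integral>\<^sup>+t. h t * indicator {2*pi..<2*pi+2*pi} t \<partial>lborel)"
    by (rule nn_integral_add) auto
  also have "\<dots> = ?I + ?I"
    by (simp only: shift nn_integral_circ)
  also have "\<dots> = 2 * ?I"
    by (rule mult_2[symmetric])
  finally have "2 * (\<integral>\<^sup>+t. h (2 * t) \<partial>circ) = 2 * ?I" .
  then show ?thesis
    by (subst (asm) ennreal_mult_cancel_left) simp
qed

lemma cis_add_2pi: "cis (t + 2*pi) = cis t"
  by (simp add: cis.ctr)

lemma distr_circ_shift: "distr circ borel (\<lambda>t. cis (t + a)) = circle_measure"
proof (rule measure_eqI)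
  fix A :: "complex set" assume "A \<in> sets (distr circ borel (\<lambda>t. cis (t + a)))"
  then have [measurable]: "A \<in> sets borel" by simp
  have [measurable]: "(\<lambda>t. cis (t + a)) \<in> measurable circ borel" "cis \<in> measurable circ borel"
    by (intro measurable_circ; measurable)+
  have *: "emeasure (distr circ borel f) A = (\<integral>\<^sup>+t. indicator A (f t) \<partial>circ)" 
    if [measurable]: "f \<in> measurable circ borel" for f
    by (subst nn_integral_distr[symmetric, where M'=borel]) auto
  have "(\<integral>\<^sup>+t. indicator A (cis (t + a)) \<partial>circ) = (\<integral>\<^sup>+t. indicator A (cis t) \<partial>circ)"
    by (rule nn_integral_circ_shift[of "\<lambda>t. indicator A (cis t)"]) (auto simp: cis_add_2pi)
  then show "emeasure (distr circ borel (\<lambda>t. cis (t + a))) A = emeasure circle_measure A"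
    by (simp add: * circle_measure_def)
qed (simp add: circle_measure_def)

lemma distr_circ_double: "distr circ borel (\<lambda>t. cis (2 * t + a)) = circle_measure"
proof (rule measure_eqI)
  fix A :: "complex set" assume "A \<in> sets (distr circ borel (\<lambda>t. cis (2 * t + a)))"
  then have [measurable]: "A \<in> sets borel" by simp
  have [measurable]: "(\<lambda>t. cis (2 * t + a)) \<in> measurable circ borel" "(\<lambda>t. cis (t + a)) \<in> measurable circ borel"
    by (intro measurable_circ; measurable)+
  have *: "emeasure (distr circ borel f) A = (\<integral>\<^sup>+t. indicator A (f t) \<partial>circ)" 
    if [measurable]: "f \<in> measurable circ borel" for f
    by (subst nn_integral_distr[symmetric, where M'=borel]) auto
  have "(\<integral>\<^sup>+t. indicator A (cis (2 * t + a)) \<partial>circ) = (\<integral>\<^sup>+t. indicator A (cis (t + a)) \<partial>circ)"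
    using cis_add_2pi[of "_ + a"]
    by (intro nn_integral_circ_double[of "\<lambda>t. indicator A (cis (t + a))"]) (auto simp: algebra_simps)
  then show "emeasure (distr circ borel (\<lambda>t. cis (2 * t + a))) A = emeasure circle_measure A"
    by (simp add: * flip: distr_circ_shift[of a])
qed (simp add: circle_measure_def)

lemma finite_measure_circ: "finite_measure circ"
  by (rule finite_measureI) (simp add: emeasure_restrict_space space_restrict_space)

lemma finite_measure_circle_measure: "finite_measure circle_measure"
  unfolding circle_measure_def
  by (intro finite_measure.finite_measure_distr finite_measure_circ measurable_circ borel_measurable_cis)

section \<open>Independent uniform angles at all sites\<close>

abbreviation torus :: "'a set \<Rightarrow> ('a \<Rightarrow> real) measure" where
  "torus \<Lambda> \<equiv> PiM \<Lambda> (\<lambda>_. circ)"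

lemma sets_circle_measure [simp, measurable_cong]: "sets circle_measure = sets borel"
  by (simp add: circle_measure_def)

lemma product_sigma_finite_circ: "product_sigma_finite (\<lambda>_. circ)"
  by (simp add: product_sigma_finite_def finite_measure.sigma_finite_measure finite_measure_circ)

lemma product_sigma_finite_circle_measure: "product_sigma_finite (\<lambda>_. circle_measure)"
  by (simp add: product_sigma_finite_def finite_measure.sigma_finite_measure finite_measure_circle_measure)

lemma emeasure_space_torus:
  assumes "finite \<Lambda>"
  shows "emeasure (torus \<Lambda>) (space (torus \<Lambda>)) = ennreal ((2 * pi) ^ card \<Lambda>)"
proof -
  have "emeasure circ (space circ) = ennreal (2 * pi)"
    by (simp add: emeasure_restrict_space space_restrict_space)
  then show ?thesis
    unfolding space_PiM
    by (subst product_sigma_finite.emeasure_PiM[OF product_sigma_finite_circ assms])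
       (simp_all only: sets.top prod_constant ennreal_power pi_ge_zero mult_nonneg_nonneg zero_le_numeral)
qed

lemma finite_measure_torus: "finite \<Lambda> \<Longrightarrow> finite_measure (torus \<Lambda>)"
  by (rule finite_measureI) (simp add: emeasure_space_torus)

lemma measure_torus: "finite \<Lambda> \<Longrightarrow> measure (torus \<Lambda>) (space (torus \<Lambda>)) = (2 * pi) ^ card \<Lambda>"
  by (simp add: measure_def emeasure_space_torus)

lemma measurable_torus_component [measurable]:
  assumes "x \<in> \<Lambda>" shows "(\<lambda>\<theta>. \<theta> x) \<in> borel_measurable (torus \<Lambda>)"
  using measurable_compose[OF measurable_component_singleton[OF assms, of "\<lambda>_. circ"] measurable_circ[of "\<lambda>t. t"]]
  by simp

lemma measurable_fst_torus [measurable]: "x \<in> \<Lambda> \<Longrightarrow> (\<lambda>p. fst p x) \<in> borel_measurable (torus \<Lambda> \<Otimes>\<^sub>M M)"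
  by (rule measurable_compose[OF measurable_fst measurable_torus_component])

lemma measurable_snd_torus [measurable]: "x \<in> \<Lambda> \<Longrightarrow> (\<lambda>p. snd p x) \<in> borel_measurable (M \<Otimes>\<^sub>M torus \<Lambda>)"
  by (rule measurable_compose[OF measurable_snd measurable_torus_component])

lemma distr_torus_cis:
  assumes \<Lambda>: "finite \<Lambda>" and f: "\<And>x. f x \<in> borel_measurable borel"
    and d: "\<And>x. distr circ borel (\<lambda>t. cis (f x t)) = circle_measure"
  shows "(\<lambda>\<theta>. \<lambda>x\<in>\<Lambda>. cis (f x (\<theta> x))) \<in> measurable (torus \<Lambda>) (PiM \<Lambda> (\<lambda>_. borel))"
    and "distr (torus \<Lambda>) (PiM \<Lambda> (\<lambda>_. borel)) (\<lambda>\<theta>. \<lambda>x\<in>\<Lambda>. cis (f x (\<theta> x))) = PiM \<Lambda> (\<lambda>_. circle_measure)"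
proof -
  have m: "(\<lambda>t. cis (f x t)) \<in> measurable circ borel" for x
    by (rule measurable_circ) (rule measurable_compose[OF f borel_measurable_cis])
  show "(\<lambda>\<theta>. \<lambda>x\<in>\<Lambda>. cis (f x (\<theta> x))) \<in> measurable (torus \<Lambda>) (PiM \<Lambda> (\<lambda>_. borel))"
  proof (rule measurable_restrict)
    fix x assume x: "x \<in> \<Lambda>"
    show "(\<lambda>\<theta>. cis (f x (\<theta> x))) \<in> borel_measurable (torus \<Lambda>)"
      using measurable_compose[OF measurable_component_singleton[OF x, of "\<lambda>_. circ"] m[of x]] .
  qed
  have s: "sets (PiM \<Lambda> (\<lambda>_. circle_measure)) = sets (PiM \<Lambda> (\<lambda>_. borel))"
    by (rule sets_PiM_cong) simp_all
  have d': "distr circ circle_measure (\<lambda>t. cis (f x t)) = circle_measure" for x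
    using d[of x] distr_cong[OF refl sets_circle_measure, of circ "\<lambda>t. cis (f x t)" "\<lambda>t. cis (f x t)"] by simp
  have m': "(\<lambda>t. cis (f x t)) \<in> measurable circ circle_measure" for x
    by (subst measurable_cong_sets[OF refl sets_circle_measure]) (rule m)
  have "distr (torus \<Lambda>) (PiM \<Lambda> (\<lambda>_. circle_measure)) (\<lambda>\<theta>. \<lambda>x\<in>\<Lambda>. cis (f x (\<theta> x))) = PiM \<Lambda> (\<lambda>_. circle_measure)"
    by (rule product_sigma_finite.distr_PiM_componentwise[OF product_sigma_finite_circ \<Lambda> m' product_sigma_finite_circle_measure d'])
  then show "distr (torus \<Lambda>) (PiM \<Lambda> (\<lambda>_. borel)) (\<lambda>\<theta>. \<lambda>x\<in>\<Lambda>. cis (f x (\<theta> x))) = PiM \<Lambda> (\<lambda>_. circle_measure)"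
    by (rule trans[OF distr_cong[OF refl s[symmetric] refl]])
qed

lemma nn_integral_torus_cis:
  assumes "finite \<Lambda>" "\<And>x. f x \<in> borel_measurable borel"
    and "\<And>x. distr circ borel (\<lambda>t. cis (f x t)) = circle_measure"
    and "g \<in> borel_measurable (PiM \<Lambda> (\<lambda>_. borel))"
  shows "(\<integral>\<^sup>+\<theta>. g (\<lambda>x\<in>\<Lambda>. cis (f x (\<theta> x))) \<partial>torus \<Lambda>) = (\<integral>\<^sup>+\<zeta>. g \<zeta> \<partial>PiM \<Lambda> (\<lambda>_. circle_measure))"
proof -
  note d = distr_torus_cis[of \<Lambda> f, OF assms(1-3)]
  show ?thesis
    unfolding d(2)[symmetric] by (rule nn_integral_distr[OF d(1), symmetric]) (simp add: assms(4))
qed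

lemma integral_torus_cis:
  fixes h :: "('a \<Rightarrow> complex) \<Rightarrow> real"
  assumes "finite \<Lambda>" "\<And>x. f x \<in> borel_measurable borel"
    and "\<And>x. distr circ borel (\<lambda>t. cis (f x t)) = circle_measure"
    and "h \<in> borel_measurable (PiM \<Lambda> (\<lambda>_. borel))"
  shows "(\<integral>\<theta>. h (\<lambda>x\<in>\<Lambda>. cis (f x (\<theta> x))) \<partial>torus \<Lambda>) = (\<integral>\<zeta>. h \<zeta> \<partial>PiM \<Lambda> (\<lambda>_. circle_measure))"
proof -
  note d = distr_torus_cis[of \<Lambda> f, OF assms(1-3)]
  show ?thesis
    unfolding d(2)[symmetric] by (rule integral_distr[OF d(1) assms(4), symmetric])
qed

lemma integral_torus_shift:
  fixes h :: "('a \<Rightarrow> complex) \<Rightarrow> real"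
  assumes "finite \<Lambda>" "h \<in> borel_measurable (PiM \<Lambda> (\<lambda>_. borel))"
  shows "(\<integral>\<theta>. h (\<lambda>x\<in>\<Lambda>. cis (\<theta> x + a x)) \<partial>torus \<Lambda>) = (\<integral>\<theta>. h (\<lambda>x\<in>\<Lambda>. cis (\<theta> x)) \<partial>torus \<Lambda>)"
  using integral_torus_cis[of \<Lambda> "\<lambda>x t. t + a x" h, OF assms(1) _ distr_circ_shift assms(2)]
    integral_torus_cis[of \<Lambda> "\<lambda>x t. t + 0" h, OF assms(1) _ distr_circ_shift assms(2)] by simp

text \<open>Translating \<open>\<alpha>\<close> by \<open>\<beta>\<close> turns \<open>(\<alpha> - \<beta>, \<alpha> + \<beta>)\<close> into \<open>(\<alpha>, \<alpha> + 2\<beta>)\<close>, and \<open>\<beta> \<mapsto> \<alpha> + 2\<beta>\<close> preserves the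
  uniform measure of the circle.\<close>
lemma nn_integral_torus_pair:
  fixes f :: "('a \<Rightarrow> complex) \<times> ('a \<Rightarrow> complex) \<Rightarrow> ennreal"
  assumes \<Lambda>: "finite \<Lambda>"
    and f [measurable]: "f \<in> borel_measurable (PiM \<Lambda> (\<lambda>_. borel) \<Otimes>\<^sub>M PiM \<Lambda> (\<lambda>_. borel))"
  shows "(\<integral>\<^sup>+p. f (\<lambda>x\<in>\<Lambda>. cis (fst p x - snd p x), \<lambda>x\<in>\<Lambda>. cis (fst p x + snd p x)) \<partial>(torus \<Lambda> \<Otimes>\<^sub>M torus \<Lambda>))
       = (\<integral>\<^sup>+p. f (\<lambda>x\<in>\<Lambda>. cis (fst p x), \<lambda>x\<in>\<Lambda>. cis (snd p x)) \<partial>(torus \<Lambda> \<Otimes>\<^sub>M torus \<Lambda>))"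
    (is "?L = ?R")
proof -
  interpret T: finite_measure "torus \<Lambda>" by (rule finite_measure_torus[OF \<Lambda>])
  interpret P: pair_sigma_finite "torus \<Lambda>" "torus \<Lambda>" ..
  let ?c = "\<lambda>\<theta>. \<lambda>x\<in>\<Lambda>. cis (\<theta> x)"
  note shift = nn_integral_torus_cis[OF \<Lambda> _ distr_circ_shift]
  note double = nn_integral_torus_cis[OF \<Lambda> _ distr_circ_double]
  have m1: "(\<lambda>p. (\<lambda>x\<in>\<Lambda>. cis (fst p x - snd p x), \<lambda>x\<in>\<Lambda>. cis (fst p x + snd p x)))
      \<in> measurable (torus \<Lambda> \<Otimes>\<^sub>M torus \<Lambda>) (PiM \<Lambda> (\<lambda>_. borel) \<Otimes>\<^sub>M PiM \<Lambda> (\<lambda>_. borel))"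
    by (rule measurable_Pair; rule measurable_restrict; measurable)
  have m2: "(\<lambda>p. (\<lambda>x\<in>\<Lambda>. cis (fst p x), \<lambda>x\<in>\<Lambda>. cis (snd p x)))
      \<in> measurable (torus \<Lambda> \<Otimes>\<^sub>M torus \<Lambda>) (PiM \<Lambda> (\<lambda>_. borel) \<Otimes>\<^sub>M PiM \<Lambda> (\<lambda>_. borel))"
    by (rule measurable_Pair; rule measurable_restrict; measurable)
  have m3: "(\<lambda>p. (\<lambda>x\<in>\<Lambda>. cis (fst p x), \<lambda>x\<in>\<Lambda>. cis (fst p x + 2 * snd p x)))
      \<in> measurable (torus \<Lambda> \<Otimes>\<^sub>M torus \<Lambda>) (PiM \<Lambda> (\<lambda>_. borel) \<Otimes>\<^sub>M PiM \<Lambda> (\<lambda>_. borel))"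
    by (rule measurable_Pair; rule measurable_restrict; measurable)
  note mf = measurable_compose[OF _ f]
  have "?L = (\<integral>\<^sup>+\<beta>. \<integral>\<^sup>+\<alpha>. f (\<lambda>x\<in>\<Lambda>. cis (\<alpha> x - \<beta> x), \<lambda>x\<in>\<Lambda>. cis (\<alpha> x + \<beta> x)) \<partial>torus \<Lambda> \<partial>torus \<Lambda>)"
    using P.nn_integral_snd[OF mf[OF m1]] by simp
  also have "\<dots> = (\<integral>\<^sup>+\<beta>. \<integral>\<^sup>+\<alpha>. f (?c \<alpha>, \<lambda>x\<in>\<Lambda>. cis (\<alpha> x + 2 * \<beta> x)) \<partial>torus \<Lambda> \<partial>torus \<Lambda>)"
  proof (rule nn_integral_cong)
    fix \<beta> :: "'a \<Rightarrow> real"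
    \<comment> \<open>If \<open>\<zeta> x\<close> has angle \<open>\<alpha> x - \<beta> x\<close>,
      then the angle \<open>\<alpha> x + \<beta> x\<close> belongs to
      \<open>\<zeta> x * cis (2 * \<beta> x)\<close>. For fixed \<open>\<beta>\<close> the integrand
      is thus a function of the translated angles alone.\<close>
    define g where "g = (\<lambda>\<zeta>. f (\<zeta>, \<lambda>x\<in>\<Lambda>. \<zeta> x * cis (2 * \<beta> x)))"
    have g: "g \<in> borel_measurable (PiM \<Lambda> (\<lambda>_. borel))"
      unfolding g_def by measurable
    have "(\<integral>\<^sup>+\<alpha>. f (\<lambda>x\<in>\<Lambda>. cis (\<alpha> x - \<beta> x), \<lambda>x\<in>\<Lambda>. cis (\<alpha> x + \<beta> x)) \<partial>torus \<Lambda>)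
        = (\<integral>\<^sup>+\<alpha>. g (\<lambda>x\<in>\<Lambda>. cis (\<alpha> x + - \<beta> x)) \<partial>torus \<Lambda>)"
      by (auto simp: g_def cis_mult add.commute intro!: nn_integral_cong arg_cong[where f=f] restrict_ext)
    also have "\<dots> = (\<integral>\<^sup>+\<alpha>. g (\<lambda>x\<in>\<Lambda>. cis (\<alpha> x + 0)) \<partial>torus \<Lambda>)"
      using shift[OF _ g, of "\<lambda>x. - \<beta> x"] shift[OF _ g, of "\<lambda>x. 0"] by simp
    also have "\<dots> = (\<integral>\<^sup>+\<alpha>. f (?c \<alpha>, \<lambda>x\<in>\<Lambda>. cis (\<alpha> x + 2 * \<beta> x)) \<partial>torus \<Lambda>)"
      by (auto simp: g_def cis_mult add.commute intro!: nn_integral_cong arg_cong[where f=f] restrict_ext)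
    finally show "(\<integral>\<^sup>+\<alpha>. f (\<lambda>x\<in>\<Lambda>. cis (\<alpha> x - \<beta> x), \<lambda>x\<in>\<Lambda>. cis (\<alpha> x + \<beta> x)) \<partial>torus \<Lambda>)
      = (\<integral>\<^sup>+\<alpha>. f (?c \<alpha>, \<lambda>x\<in>\<Lambda>. cis (\<alpha> x + 2 * \<beta> x)) \<partial>torus \<Lambda>)" .
  qed
  also have "\<dots> = (\<integral>\<^sup>+\<alpha>. \<integral>\<^sup>+\<beta>. f (?c \<alpha>, \<lambda>x\<in>\<Lambda>. cis (\<alpha> x + 2 * \<beta> x)) \<partial>torus \<Lambda> \<partial>torus \<Lambda>)"
    using P.Fubini[OF mf[OF m3]] by simp
  also have "\<dots> = (\<integral>\<^sup>+\<alpha>. \<integral>\<^sup>+\<beta>. f (?c \<alpha>, ?c \<beta>) \<partial>torus \<Lambda> \<partial>torus \<Lambda>)"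
  proof (rule nn_integral_cong)
    fix \<alpha> :: "'a \<Rightarrow> real" assume \<alpha>: "\<alpha> \<in> space (torus \<Lambda>)"
    have g: "(\<lambda>\<zeta>. f (?c \<alpha>, \<zeta>)) \<in> borel_measurable (PiM \<Lambda> (\<lambda>_. borel))"
      by measurable
    show "(\<integral>\<^sup>+\<beta>. f (?c \<alpha>, \<lambda>x\<in>\<Lambda>. cis (\<alpha> x + 2 * \<beta> x)) \<partial>torus \<Lambda>) = (\<integral>\<^sup>+\<beta>. f (?c \<alpha>, ?c \<beta>) \<partial>torus \<Lambda>)"
      using double[OF _ g, of "\<lambda>x. \<alpha> x"] shift[OF _ g, of "\<lambda>x. 0"] by (simp add: add.commute)
  qed
  also have "\<dots> = ?R"
    using T.nn_integral_fst[OF mf[OF m2]] by simp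
  finally show ?thesis .
qed

text \<open>The nonnegative case, applied to indicators, identifies the two image measures; signed
  integrands follow by integrating against the common image.\<close>

lemma integral_torus_pair:
  fixes f :: "('a \<Rightarrow> complex) \<times> ('a \<Rightarrow> complex) \<Rightarrow> real"
  assumes \<Lambda>: "finite \<Lambda>"
    and f [measurable]: "f \<in> borel_measurable (PiM \<Lambda> (\<lambda>_. borel) \<Otimes>\<^sub>M PiM \<Lambda> (\<lambda>_. borel))"
  shows "(\<integral>p. f (\<lambda>x\<in>\<Lambda>. cis (fst p x - snd p x), \<lambda>x\<in>\<Lambda>. cis (fst p x + snd p x)) \<partial>(torus \<Lambda> \<Otimes>\<^sub>M torus \<Lambda>))
       = (\<integral>p. f (\<lambda>x\<in>\<Lambda>. cis (fst p x), \<lambda>x\<in>\<Lambda>. cis (snd p x)) \<partial>(torus \<Lambda> \<Otimes>\<^sub>M torus \<Lambda>))"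
proof -
  let ?T = "torus \<Lambda> \<Otimes>\<^sub>M torus \<Lambda>" and ?B = "PiM \<Lambda> (\<lambda>_. borel :: complex measure) \<Otimes>\<^sub>M PiM \<Lambda> (\<lambda>_. borel :: complex measure)"
  let ?g = "\<lambda>p. (\<lambda>x\<in>\<Lambda>. cis (fst p x - snd p x), \<lambda>x\<in>\<Lambda>. cis (fst p x + snd p x))"
  let ?h = "\<lambda>p. (\<lambda>x\<in>\<Lambda>. cis (fst p x), \<lambda>x\<in>\<Lambda>. cis (snd p x))"
  have g [measurable]: "?g \<in> measurable ?T ?B" and h [measurable]: "?h \<in> measurable ?T ?B"
    by (rule measurable_Pair; rule measurable_restrict; measurable)+
  have *: "emeasure (distr ?T ?B k) A = (\<integral>\<^sup>+p. indicator A (k p) \<partial>?T)" 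
    if [measurable]: "k \<in> measurable ?T ?B" "A \<in> sets ?B" for k A
    by (subst nn_integral_distr[symmetric, where M'="?B"]) auto
  have "distr ?T ?B ?g = distr ?T ?B ?h"
  proof (rule measure_eqI)
    fix A assume "A \<in> sets (distr ?T ?B ?g)"
    then have A [measurable]: "A \<in> sets ?B" by simp
    show "emeasure (distr ?T ?B ?g) A = emeasure (distr ?T ?B ?h) A"
      using nn_integral_torus_pair[OF \<Lambda>, of "indicator A"] by (simp add: *)
  qed simp
  note d = this
  show ?thesis
    using integral_distr[OF g f] integral_distr[OF h f] unfolding d by (rule trans[OF sym])
qed

section \<open>Ginibre's inequality\<close>

text \<open>Finite sums of squares \<open>g \<otimes> g\<close>: a multiplicatively closed cone on which integration
  against \<open>M \<otimes> M\<close> is nonnegative.\<close>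
inductive pos_kernel :: "'b measure \<Rightarrow> ('b \<times> 'b \<Rightarrow> real) \<Rightarrow> bool" for M where
  square: "g \<in> borel_measurable M \<Longrightarrow> (\<And>x. \<bar>g x\<bar> \<le> C) \<Longrightarrow> pos_kernel M (\<lambda>p. g (fst p) * g (snd p))"
| add: "pos_kernel M k \<Longrightarrow> pos_kernel M l \<Longrightarrow> pos_kernel M (\<lambda>p. k p + l p)"

lemma pos_kernel_measurable: "pos_kernel M k \<Longrightarrow> k \<in> borel_measurable (M \<Otimes>\<^sub>M M)"
proof (induction rule: pos_kernel.induct)
  case (square g C)
  show ?case
    by (intro borel_measurable_times measurable_compose[OF measurable_fst square(1)] measurable_compose[OF measurable_snd square(1)])
next
  case (add k l)
  show ?case by (rule borel_measurable_add[OF add.IH])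
qed

lemma pos_kernel_bounded: "pos_kernel M k \<Longrightarrow> \<exists>C. \<forall>p. \<bar>k p\<bar> \<le> C"
proof (induction rule: pos_kernel.induct)
  case (square g C)
  have "\<bar>g (fst p) * g (snd p)\<bar> \<le> C * C" for p
    unfolding abs_mult by (intro mult_mono square abs_ge_zero order_trans[OF abs_ge_zero square(2)])
  then show ?case by blast
next
  case (add k l)
  then obtain C D where "\<forall>p. \<bar>k p\<bar> \<le> C" "\<forall>p. \<bar>l p\<bar> \<le> D" by blast
  then have "\<bar>k p + l p\<bar> \<le> C + D" for p
    using abs_triangle_ineq[of "k p" "l p"] by (metis add_mono order_trans)
  then show ?case by blast
qed

lemma pos_kernel_const: "0 \<le> c \<Longrightarrow> pos_kernel M (\<lambda>_. c)"
  using pos_kernel.square[of "\<lambda>_. sqrt c" M "sqrt c"] by simp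

lemma pos_kernel_mult_square:
  assumes "pos_kernel M k" and g: "g \<in> borel_measurable M" "\<And>x. \<bar>g x\<bar> \<le> C"
  shows "pos_kernel M (\<lambda>p. k p * (g (fst p) * g (snd p)))"
  using assms(1)
proof induction
  case (square h D)
  have "\<bar>h x * g x\<bar> \<le> D * C" for x
    unfolding abs_mult by (intro mult_mono square g abs_ge_zero order_trans[OF abs_ge_zero square(2)])
  then have "pos_kernel M (\<lambda>p. (h (fst p) * g (fst p)) * (h (snd p) * g (snd p)))"
    using square g by (intro pos_kernel.square[of "\<lambda>x. h x * g x"] borel_measurable_times)
  then show ?case by (simp add: mult_ac)
next
  case (add k l)
  from pos_kernel.add[OF add.IH] show ?case by (simp add: distrib_right)
qed

text \<open>A product of squares is a square, \<open>(h \<otimes> h) * (g \<otimes> g) = (h * g)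
  \<otimes> (h * g)\<close>, and products distribute over sums in each factor. This closure brings
  all powers of an energy into the cone.\<close>

lemma pos_kernel_mult:
  assumes k: "pos_kernel M k" and l: "pos_kernel M l"
  shows "pos_kernel M (\<lambda>p. k p * l p)"
  using l
proof induction
  case (square g C)
  then show ?case by (intro pos_kernel_mult_square[OF k])
next
  case (add l l')
  from pos_kernel.add[OF add.IH] show ?case by (simp add: distrib_left)
qed

lemma pos_kernel_scale: "0 \<le> c \<Longrightarrow> pos_kernel M k \<Longrightarrow> pos_kernel M (\<lambda>p. c * k p)"
  by (rule pos_kernel_mult[OF pos_kernel_const])

lemma pos_kernel_power: "pos_kernel M k \<Longrightarrow> pos_kernel M (\<lambda>p. k p ^ n)"
  by (induction n) (auto intro: pos_kernel_const pos_kernel_mult)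

lemma pos_kernel_sum: "finite I \<Longrightarrow> (\<And>i. i \<in> I \<Longrightarrow> pos_kernel M (k i)) \<Longrightarrow> pos_kernel M (\<lambda>p. \<Sum>i\<in>I. k i p)"
proof (induction I rule: finite_induct)
  case empty
  show ?case using pos_kernel_const[of 0 M] by simp
next
  case (insert i I)
  have "pos_kernel M (\<lambda>p. k i p + (\<Sum>i\<in>I. k i p))"
    using insert by (intro pos_kernel.add) auto
  then show ?case using insert.hyps by simp
qed

lemma (in finite_measure) integrable_pair_bounded:
  fixes k :: "'a \<times> 'a \<Rightarrow> real"
  assumes "k \<in> borel_measurable (M \<Otimes>\<^sub>M M)" "\<And>p. \<bar>k p\<bar> \<le> C"
  shows "integrable (M \<Otimes>\<^sub>M M) k"
proof -
  interpret P: finite_measure "M \<Otimes>\<^sub>M M"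
    by (rule finite_measure_pair_measure) (rule finite_measure_axioms)+
  show ?thesis
    by (rule P.integrable_const_bound[where B=C, OF AE_I2 assms(1)]) (simp add: assms(2))
qed

lemma (in finite_measure) integral_tensor:
  fixes f g :: "'a \<Rightarrow> real"
  assumes f: "f \<in> borel_measurable M" "\<And>x. \<bar>f x\<bar> \<le> C" and g: "g \<in> borel_measurable M" "\<And>x. \<bar>g x\<bar> \<le> D"
  shows "integrable (M \<Otimes>\<^sub>M M) (\<lambda>p. f (fst p) * g (snd p))"
    and "(\<integral>p. f (fst p) * g (snd p) \<partial>(M \<Otimes>\<^sub>M M)) = (\<integral>x. f x \<partial>M) * (\<integral>x. g x \<partial>M)"
proof -
  interpret P: pair_sigma_finite M M ..
  have "\<bar>f (fst p) * g (snd p)\<bar> \<le> C * D" for p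
    unfolding abs_mult by (intro mult_mono f g abs_ge_zero order_trans[OF abs_ge_zero f(2)])
  then show i: "integrable (M \<Otimes>\<^sub>M M) (\<lambda>p. f (fst p) * g (snd p))"
    by (rule integrable_pair_bounded[rotated])
      (intro borel_measurable_times measurable_compose[OF measurable_fst f(1)] measurable_compose[OF measurable_snd g(1)])
  show "(\<integral>p. f (fst p) * g (snd p) \<partial>(M \<Otimes>\<^sub>M M)) = (\<integral>x. f x \<partial>M) * (\<integral>x. g x \<partial>M)"
    using P.integral_fst'[OF i] by simp
qed

text \<open>The integral of \<open>g \<otimes> g\<close> is the square of the integral of
  \<open>g\<close>.\<close>

lemma (in finite_measure) integral_pos_kernel_nonneg:
  assumes "pos_kernel M k" shows "0 \<le> (\<integral>p. k p \<partial>(M \<Otimes>\<^sub>M M))"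
  using assms
proof induction
  case (square g C)
  show ?case unfolding integral_tensor(2)[OF square square] by simp
next
  case (add k l)
  have i: "integrable (M \<Otimes>\<^sub>M M) k" if "pos_kernel M k" for k
    using pos_kernel_bounded[OF that] integrable_pair_bounded[OF pos_kernel_measurable[OF that]] by blast
  show ?case
    using add.IH by (subst Bochner_Integration.integral_add[OF i[OF add.hyps(1)] i[OF add.hyps(2)]]) simp
qed

text \<open>The cone contains finite sums only, so the exponential is approached by
  \<open>(1 + s / n) ^ n\<close>, which lies in it, and the sign passes to the limit by dominated
  convergence.\<close>

lemma (in finite_measure) integral_pos_kernel_exp_nonneg:
  assumes k: "pos_kernel M k" and s: "pos_kernel M s"
  shows "0 \<le> (\<integral>p. k p * exp (s p) \<partial>(M \<Otimes>\<^sub>M M))"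
proof (rule LIMSEQ_le_const)
  note mk = pos_kernel_measurable[OF k] and ms = pos_kernel_measurable[OF s]
  obtain C where C: "\<And>p. \<bar>k p\<bar> \<le> C" using pos_kernel_bounded[OF k] by blast
  obtain D where D: "\<And>p. \<bar>s p\<bar> \<le> D" using pos_kernel_bounded[OF s] by blast
  have C0: "0 \<le> C" and D0: "0 \<le> D"
    using order_trans[OF abs_ge_zero C] order_trans[OF abs_ge_zero D] by auto
  interpret P: finite_measure "M \<Otimes>\<^sub>M M"
    by (rule finite_measure_pair_measure) (rule finite_measure_axioms)+
  show "(\<lambda>n. \<integral>p. k p * (1 + s p / real n) ^ n \<partial>(M \<Otimes>\<^sub>M M)) \<longlonglongrightarrow> (\<integral>p. k p * exp (s p) \<partial>(M \<Otimes>\<^sub>M M))"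
  proof (rule integral_dominated_convergence[where w="\<lambda>_. C * exp D"])
    show "AE p in M \<Otimes>\<^sub>M M. (\<lambda>n. k p * (1 + s p / real n) ^ n) \<longlonglongrightarrow> k p * exp (s p)"
      by (intro AE_I2 tendsto_mult tendsto_const tendsto_exp_limit_sequentially)
    fix n
    have "\<bar>k p * (1 + s p / real n) ^ n\<bar> \<le> C * exp D" for p
    proof -
      have "\<bar>1 + s p / real n\<bar> \<le> 1 + D / real n"
        using D[of p] by (intro order_trans[OF abs_triangle_ineq]) (simp add: divide_right_mono)
      then have "\<bar>1 + s p / real n\<bar> ^ n \<le> (1 + D / real n) ^ n"
        by (rule power_mono) simp
      \<comment> \<open>At \<open>n = 0\<close> the power is 1, which \<open>exp D\<close> dominates
        because \<open>D\<close> is nonnegative.\<close>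
      also have "\<dots> \<le> exp D"
        using D0 by (cases "n = 0") (auto intro!: exp_ge_one_plus_x_over_n_power_n)
      finally show ?thesis
        unfolding abs_mult power_abs by (intro mult_mono C C0) simp_all
    qed
    then show "AE p in M \<Otimes>\<^sub>M M. norm (k p * (1 + s p / real n) ^ n) \<le> C * exp D"
      by simp
    show "(\<lambda>p. k p * (1 + s p / real n) ^ n) \<in> borel_measurable (M \<Otimes>\<^sub>M M)"
      by (intro borel_measurable_times mk borel_measurable_power borel_measurable_add borel_measurable_const borel_measurable_divide ms)
  next
    show "(\<lambda>p. k p * exp (s p)) \<in> borel_measurable (M \<Otimes>\<^sub>M M)"
      by (intro borel_measurable_times mk measurable_compose[OF ms borel_measurable_exp])
    show "integrable (M \<Otimes>\<^sub>M M) (\<lambda>_. C * exp D)"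
      by (rule P.integrable_const)
  qed
  have "0 \<le> (\<integral>p. k p * (1 + s p / real n) ^ n \<partial>(M \<Otimes>\<^sub>M M))" for n
  proof -
    have "pos_kernel M (\<lambda>p. 1 + inverse (real n) * s p)"
      by (rule pos_kernel.add[OF pos_kernel_const pos_kernel_scale[OF _ s]]) auto
    from integral_pos_kernel_nonneg[OF pos_kernel_mult[OF k pos_kernel_power[OF this, of n]]]
    show ?thesis by (simp add: divide_inverse mult.commute)
  qed
  then show "\<exists>N. \<forall>n\<ge>N. 0 \<le> (\<integral>p. k p * (1 + s p / real n) ^ n \<partial>(M \<Otimes>\<^sub>M M))"
    by blast
qed

section \<open>The angle model: energy, duplication and comparison of couplings\<close>

definition XY_energy :: "'a set \<Rightarrow> ('a \<Rightarrow> 'a \<Rightarrow> real) \<Rightarrow> ('a \<Rightarrow> 'a \<Rightarrow> real) \<Rightarrow> ('a \<Rightarrow> real) \<Rightarrow> real" where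
  "XY_energy \<Lambda> A B \<theta> = bond_sum \<Lambda> (\<lambda>x y. A x y * cos (\<theta> x - \<theta> y) + B x y * cos (2 * (\<theta> x - \<theta> y)))"

text \<open>Ginibre's duplication: in the variables \<open>\<theta> = \<alpha> - \<beta>\<close>, \<open>\<theta>' = \<alpha> + \<beta>\<close> both \<open>cos \<theta> + cos \<theta>'\<close> and
  \<open>cos \<theta> - cos \<theta>'\<close> are of the form \<open>2 g(\<alpha>) g(\<beta>)\<close>.\<close>
lemma pos_kernel_cos_pair:
  fixes c :: real
  assumes xy: "x \<in> \<Lambda>" "y \<in> \<Lambda>" and c: "\<bar>c'\<bar> \<le> c"
  shows "pos_kernel (torus \<Lambda>)
    (\<lambda>p. c * cos (m * ((fst p x - snd p x) - (fst p y - snd p y))) + c' * cos (m * ((fst p x + snd p x) - (fst p y + snd p y))))"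
proof -
  define C where "C = (\<lambda>\<theta>::'a \<Rightarrow> real. cos (m * (\<theta> x - \<theta> y)))"
  define S where "S = (\<lambda>\<theta>::'a \<Rightarrow> real. sin (m * (\<theta> x - \<theta> y)))"
  have d: "(\<lambda>\<theta>. m * (\<theta> x - \<theta> y)) \<in> borel_measurable (torus \<Lambda>)"
    by (intro borel_measurable_times borel_measurable_const borel_measurable_diff measurable_torus_component xy)
  have C: "C \<in> borel_measurable (torus \<Lambda>)"
    unfolding C_def by (rule measurable_compose[OF d borel_measurable_cos])
  have S: "S \<in> borel_measurable (torus \<Lambda>)"
    unfolding S_def by (rule measurable_compose[OF d borel_measurable_sin])
  \<comment> \<open>Expanding both cosines gives \<open>c * cos (u - v) + c' * cos (u + v) = (c +
    c') * cos u * cos v + (c - c') * sin u * sin v\<close>. The condition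
    \<open>\<bar>c'\<bar> \<le> c\<close> says exactly that both coefficients are
    nonnegative.\<close>
  have "pos_kernel (torus \<Lambda>) (\<lambda>p. (c + c') * (C (fst p) * C (snd p)) + (c - c') * (S (fst p) * S (snd p)))"
    by (rule pos_kernel.add[OF pos_kernel_scale[OF _ pos_kernel.square[OF C, of 1]] pos_kernel_scale[OF _ pos_kernel.square[OF S, of 1]]])
      (use c in \<open>auto simp: C_def S_def\<close>)
  also have "(\<lambda>p. (c + c') * (C (fst p) * C (snd p)) + (c - c') * (S (fst p) * S (snd p)))
    = (\<lambda>p. c * cos (m * ((fst p x - snd p x) - (fst p y - snd p y))) + c' * cos (m * ((fst p x + snd p x) - (fst p y + snd p y))))"
  proof
    fix p :: "('a \<Rightarrow> real) \<times> ('a \<Rightarrow> real)"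
    define u where "u = m * (fst p x - fst p y)"
    define v where "v = m * (snd p x - snd p y)"
    have e: "m * ((fst p x - snd p x) - (fst p y - snd p y)) = u - v" "m * ((fst p x + snd p x) - (fst p y + snd p y)) = u + v"
      by (simp_all add: u_def v_def algebra_simps)
    show "(c + c') * (C (fst p) * C (snd p)) + (c - c') * (S (fst p) * S (snd p))
      = c * cos (m * ((fst p x - snd p x) - (fst p y - snd p y))) + c' * cos (m * ((fst p x + snd p x) - (fst p y + snd p y)))"
      unfolding C_def S_def e u_def[symmetric] v_def[symmetric] cos_add cos_diff by (simp add: algebra_simps)
  qed
  finally show ?thesis .
qed

lemma finite_bonds: "finite \<Lambda> \<Longrightarrow> finite {(x,y). x \<in> \<Lambda> \<and> y \<in> \<Lambda> \<and> x \<noteq> y}"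
  by (rule finite_subset[of _ "\<Lambda> \<times> \<Lambda>"]) auto

lemma pos_kernel_XY_energy:
  assumes \<Lambda>: "finite \<Lambda>"
    and A: "\<And>u v. u \<in> \<Lambda> \<Longrightarrow> v \<in> \<Lambda> \<Longrightarrow> u \<noteq> v \<Longrightarrow> \<bar>A' u v\<bar> \<le> A u v"
    and B: "\<And>u v. u \<in> \<Lambda> \<Longrightarrow> v \<in> \<Lambda> \<Longrightarrow> u \<noteq> v \<Longrightarrow> \<bar>B' u v\<bar> \<le> B u v"
  shows "pos_kernel (torus \<Lambda>)
    (\<lambda>p. XY_energy \<Lambda> A B (\<lambda>x. fst p x - snd p x) + XY_energy \<Lambda> A' B' (\<lambda>x. fst p x + snd p x))"
proof -
  let ?b = "{(x,y). x \<in> \<Lambda> \<and> y \<in> \<Lambda> \<and> x \<noteq> y}"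
  let ?k = "\<lambda>m c c' x y p. c * cos (m * ((fst p x - snd p x) - (fst p y - snd p y))) + c' * cos (m * ((fst p x + snd p x) - (fst p y + snd p y)))"
  have "pos_kernel (torus \<Lambda>) (\<lambda>p. 1/2 * (\<Sum>b\<in>?b. (?k 1 (A (fst b) (snd b)) (A' (fst b) (snd b)) (fst b) (snd b) p
      + ?k 2 (B (fst b) (snd b)) (B' (fst b) (snd b)) (fst b) (snd b) p)))"
    by (rule pos_kernel_scale, simp, rule pos_kernel_sum[OF finite_bonds[OF \<Lambda>]], rule pos_kernel.add;
        rule pos_kernel_cos_pair) (auto intro: A B)
  also have "(\<lambda>p. 1/2 * (\<Sum>b\<in>?b. (?k 1 (A (fst b) (snd b)) (A' (fst b) (snd b)) (fst b) (snd b) p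
      + ?k 2 (B (fst b) (snd b)) (B' (fst b) (snd b)) (fst b) (snd b) p)))
    = (\<lambda>p. XY_energy \<Lambda> A B (\<lambda>x. fst p x - snd p x) + XY_energy \<Lambda> A' B' (\<lambda>x. fst p x + snd p x))"
    unfolding XY_energy_def bond_sum_def case_prod_unfold add_divide_distrib[symmetric] sum.distrib[symmetric]
    by (simp add: algebra_simps)
  finally show ?thesis .
qed

lemma measurable_XY_energy: "XY_energy \<Lambda> A B \<in> borel_measurable (torus \<Lambda>)"
proof -
  have "(\<lambda>\<theta>. A x y * cos (\<theta> x - \<theta> y) + B x y * cos (2 * (\<theta> x - \<theta> y))) \<in> borel_measurable (torus \<Lambda>)"
    if "x \<in> \<Lambda>" "y \<in> \<Lambda>" for x y
    by (intro borel_measurable_add borel_measurable_times borel_measurable_const borel_measurable_diff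
        measurable_compose[OF _ borel_measurable_cos] measurable_torus_component that)
  then show ?thesis
    unfolding XY_energy_def[abs_def] bond_sum_def case_prod_unfold
    by (intro borel_measurable_divide borel_measurable_sum borel_measurable_const) blast
qed

lemma XY_energy_bounded: "\<exists>C. \<forall>\<theta>. \<bar>XY_energy \<Lambda> A B \<theta>\<bar> \<le> C"
proof -
  have *: "\<bar>a * cos s + b * cos t\<bar> \<le> \<bar>a\<bar> + \<bar>b\<bar>" for a b s t :: real
    using mult_left_mono[OF abs_cos_le_one[of s], of "\<bar>a\<bar>"] mult_left_mono[OF abs_cos_le_one[of t], of "\<bar>b\<bar>"]
      abs_triangle_ineq[of "a * cos s" "b * cos t"] by (simp add: abs_mult)
  have "\<bar>XY_energy \<Lambda> A B \<theta>\<bar> \<le> bond_sum \<Lambda> (\<lambda>x y. \<bar>A x y\<bar> + \<bar>B x y\<bar>)" for \<theta>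
    unfolding XY_energy_def bond_sum_def case_prod_unfold abs_divide abs_numeral
    by (rule divide_right_mono[OF order_trans[OF sum_abs sum_mono[OF *]]]) simp
  then show ?thesis by blast
qed

text \<open>\<open>XY_energy\<close> as a function on the product of circles, the form in which the
  invariance results for \<open>cis\<close> of the angles apply.\<close>

definition circle_energy :: "'a set \<Rightarrow> ('a \<Rightarrow> 'a \<Rightarrow> real) \<Rightarrow> ('a \<Rightarrow> 'a \<Rightarrow> real) \<Rightarrow> ('a \<Rightarrow> complex) \<Rightarrow> real" where
  "circle_energy \<Lambda> A B \<zeta> = bond_sum \<Lambda> (\<lambda>x y. A x y * Re (\<zeta> x * cnj (\<zeta> y)) + B x y * Re ((\<zeta> x * cnj (\<zeta> y)) ^ 2))"

lemma cis_times_cnj: "(cis s * cnj (cis t)) ^ m = cis (real m * (s - t))"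
  unfolding cis_cnj cis_mult Complex.DeMoivre by simp

lemma circle_energy_cis: "circle_energy \<Lambda> A B (\<lambda>x\<in>\<Lambda>. cis (f x)) = XY_energy \<Lambda> A B f"
proof -
  let ?c = "\<lambda>x\<in>\<Lambda>. cis (f x)"
  have Re1: "Re (cis s * cnj (cis t)) = cos (s - t)" and Re2: "Re ((cis s * cnj (cis t)) ^ 2) = cos (2 * (s - t))" for s t
    using cis_times_cnj[of s t 1] cis_times_cnj[of s t 2] by (simp_all only: power_one_right cis.sel of_nat_1 mult_1 of_nat_numeral)
  have "A x y * Re (?c x * cnj (?c y)) + B x y * Re ((?c x * cnj (?c y)) ^ 2)
      = A x y * cos (f x - f y) + B x y * cos (2 * (f x - f y))" if "x \<in> \<Lambda>" "y \<in> \<Lambda>" for x y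
    unfolding restrict_apply'[OF that(1)] restrict_apply'[OF that(2)] Re1 Re2 ..
  then show ?thesis
    unfolding circle_energy_def XY_energy_def bond_sum_def case_prod_unfold
    by (intro arg_cong[where f="\<lambda>s. s / 2"] sum.cong refl) blast
qed

lemma measurable_Re_power:
  assumes "x \<in> \<Lambda>" "y \<in> \<Lambda>"
  shows "(\<lambda>\<zeta>. Re ((\<zeta> x * cnj (\<zeta> y)) ^ m)) \<in> borel_measurable (PiM \<Lambda> (\<lambda>_. borel))"
proof -
  have c: "(\<lambda>p::complex \<times> complex. Re ((fst p * cnj (snd p)) ^ m)) \<in> borel_measurable borel"
    by (intro borel_measurable_continuous_onI continuous_intros)
  have "(\<lambda>\<zeta>. (\<zeta> x, \<zeta> y)) \<in> measurable (PiM \<Lambda> (\<lambda>_. borel)) (borel :: (complex \<times> complex) measure)"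
    by (intro borel_measurable_Pair measurable_component_singleton assms)
  from measurable_compose[OF this c] show ?thesis unfolding fst_conv snd_conv .
qed

lemma measurable_circle_energy: "circle_energy \<Lambda> A B \<in> borel_measurable (PiM \<Lambda> (\<lambda>_. borel))"
proof -
  have "(\<lambda>\<zeta>. A x y * Re (\<zeta> x * cnj (\<zeta> y)) + B x y * Re ((\<zeta> x * cnj (\<zeta> y)) ^ 2)) \<in> borel_measurable (PiM \<Lambda> (\<lambda>_. borel))"
    if "x \<in> \<Lambda>" "y \<in> \<Lambda>" for x y
    by (intro borel_measurable_add borel_measurable_times borel_measurable_const measurable_Re_power[OF that]
      measurable_Re_power[OF that, of 1, unfolded power_one_right])
  then show ?thesis
    unfolding circle_energy_def[abs_def] bond_sum_def case_prod_unfold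
    by (intro borel_measurable_divide borel_measurable_sum borel_measurable_const) blast
qed

text \<open>With denominators cleared, this says that the modulus of the correlation in the model
  \<open>A', B'\<close> is at most the correlation in the model \<open>A, B\<close>; the weaker
  couplings may have any sign. The case \<open>A' = A\<close>, \<open>B' = B\<close> gives
  nonnegativity of correlations, and for \<open>m = 0\<close> the correlation integral is the
  partition function.\<close>

lemma XY_comparison:
  fixes m :: nat
  assumes \<Lambda>: "finite \<Lambda>" and xy: "x \<in> \<Lambda>" "y \<in> \<Lambda>"
    and A: "\<And>u v. u \<in> \<Lambda> \<Longrightarrow> v \<in> \<Lambda> \<Longrightarrow> u \<noteq> v \<Longrightarrow> \<bar>A' u v\<bar> \<le> A u v"
    and B: "\<And>u v. u \<in> \<Lambda> \<Longrightarrow> v \<in> \<Lambda> \<Longrightarrow> u \<noteq> v \<Longrightarrow> \<bar>B' u v\<bar> \<le> B u v"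
  shows "\<bar>\<integral>\<theta>. cos (real m * (\<theta> x - \<theta> y)) * exp (XY_energy \<Lambda> A' B' \<theta>) \<partial>torus \<Lambda>\<bar> * (\<integral>\<theta>. exp (XY_energy \<Lambda> A B \<theta>) \<partial>torus \<Lambda>)
    \<le> (\<integral>\<theta>. cos (real m * (\<theta> x - \<theta> y)) * exp (XY_energy \<Lambda> A B \<theta>) \<partial>torus \<Lambda>) * (\<integral>\<theta>. exp (XY_energy \<Lambda> A' B' \<theta>) \<partial>torus \<Lambda>)"
proof -
  interpret T: finite_measure "torus \<Lambda>" by (rule finite_measure_torus[OF \<Lambda>])
  let ?T = "torus \<Lambda> \<Otimes>\<^sub>M torus \<Lambda>"
  define f where "f = (\<lambda>\<theta>. cos (real m * (\<theta> x - \<theta> y)))"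
  define e where "e = (\<lambda>\<theta>. exp (XY_energy \<Lambda> A B \<theta>))"
  define e' where "e' = (\<lambda>\<theta>. exp (XY_energy \<Lambda> A' B' \<theta>))"
  have d: "(\<lambda>\<theta>. real m * (\<theta> x - \<theta> y)) \<in> borel_measurable (torus \<Lambda>)"
    by (intro borel_measurable_times borel_measurable_const borel_measurable_diff measurable_torus_component xy)
  have mf: "f \<in> borel_measurable (torus \<Lambda>)"
    unfolding f_def by (rule measurable_compose[OF d borel_measurable_cos])
  have me: "e \<in> borel_measurable (torus \<Lambda>)" "e' \<in> borel_measurable (torus \<Lambda>)"
    unfolding e_def e'_def by (rule measurable_compose[OF measurable_XY_energy borel_measurable_exp])+
  obtain C C' where "\<And>\<theta>. \<bar>XY_energy \<Lambda> A B \<theta>\<bar> \<le> C" "\<And>\<theta>. \<bar>XY_energy \<Lambda> A' B' \<theta>\<bar> \<le> C'"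
    using XY_energy_bounded by metis
  then have be: "\<bar>e \<theta>\<bar> \<le> exp C" "\<bar>e' \<theta>\<bar> \<le> exp C'" for \<theta>
    unfolding e_def e'_def using abs_le_D1 by auto
  have bf: "\<bar>f \<theta>\<bar> \<le> 1" for \<theta> by (simp add: f_def)
  have bfe: "\<bar>f \<theta> * e \<theta>\<bar> \<le> 1 * exp C" "\<bar>f \<theta> * e' \<theta>\<bar> \<le> 1 * exp C'" for \<theta>
    unfolding abs_mult by (intro mult_mono bf be; simp)+
  note mfe = borel_measurable_times[OF mf me(1)] borel_measurable_times[OF mf me(2)]
  have key: "0 \<le> (\<integral>\<theta>. f \<theta> * e \<theta> \<partial>torus \<Lambda>) * (\<integral>\<theta>. e' \<theta> \<partial>torus \<Lambda>) + s * ((\<integral>\<theta>. e \<theta> \<partial>torus \<Lambda>) * (\<integral>\<theta>. f \<theta> * e' \<theta> \<partial>torus \<Lambda>))"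
    if s: "\<bar>s\<bar> \<le> 1" for s
  proof -
    \<comment> \<open>\<open>F\<close> is read in two ways: at
      \<open>(\<alpha> - \<beta>, \<alpha> + \<beta>)\<close> it is a member of the cone times the
      exponential of another, hence has nonnegative integral; at \<open>(\<alpha>, \<beta>)\<close>
      its integral is a combination of products of single integrals. The values \<open>s = 1\<close>
      and \<open>s = -1\<close> later give the two halves of the absolute value.\<close>
    define F where "F = (\<lambda>(\<zeta>, \<eta>). (Re ((\<zeta> x * cnj (\<zeta> y)) ^ m) + s * Re ((\<eta> x * cnj (\<eta> y)) ^ m))
      * exp (circle_energy \<Lambda> A B \<zeta> + circle_energy \<Lambda> A' B' \<eta>))"
    have F: "F \<in> borel_measurable (PiM \<Lambda> (\<lambda>_. borel) \<Otimes>\<^sub>M PiM \<Lambda> (\<lambda>_. borel))"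
      unfolding F_def case_prod_unfold
      by (intro borel_measurable_times borel_measurable_add borel_measurable_const measurable_compose[OF _ borel_measurable_exp]
        measurable_compose[OF measurable_fst measurable_Re_power[OF xy]] measurable_compose[OF measurable_snd measurable_Re_power[OF xy]]
        measurable_compose[OF measurable_fst measurable_circle_energy] measurable_compose[OF measurable_snd measurable_circle_energy])
    have F_cis: "F (\<lambda>x\<in>\<Lambda>. cis (g x), \<lambda>x\<in>\<Lambda>. cis (h x)) = (f g + s * f h) * exp (XY_energy \<Lambda> A B g + XY_energy \<Lambda> A' B' h)" for g h
      using xy by (simp add: F_def f_def circle_energy_cis cis_times_cnj)
    have "0 \<le> (\<integral>p. F (\<lambda>x\<in>\<Lambda>. cis (fst p x - snd p x), \<lambda>x\<in>\<Lambda>. cis (fst p x + snd p x)) \<partial>?T)"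
      unfolding F_cis f_def
      using T.integral_pos_kernel_exp_nonneg[OF pos_kernel_cos_pair[OF xy s, of m] pos_kernel_XY_energy[OF \<Lambda> A B]] by simp
    also have "\<dots> = (\<integral>p. F (\<lambda>x\<in>\<Lambda>. cis (fst p x), \<lambda>x\<in>\<Lambda>. cis (snd p x)) \<partial>?T)"
      by (rule integral_torus_pair[OF \<Lambda> F])
    also have "\<dots> = (\<integral>p. (f (fst p) * e (fst p)) * e' (snd p) + s * (e (fst p) * (f (snd p) * e' (snd p))) \<partial>?T)"
      unfolding F_cis by (simp add: e_def e'_def exp_add algebra_simps)
    also have "\<dots> = (\<integral>p. (f (fst p) * e (fst p)) * e' (snd p) \<partial>?T) + (\<integral>p. s * (e (fst p) * (f (snd p) * e' (snd p))) \<partial>?T)"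
      by (rule Bochner_Integration.integral_add[OF T.integral_tensor(1)[OF mfe(1) bfe(1) me(2) be(2)]
          integrable_mult_right[OF T.integral_tensor(1)[OF me(1) be(1) mfe(2) bfe(2)]]])
    also have "\<dots> = (\<integral>\<theta>. f \<theta> * e \<theta> \<partial>torus \<Lambda>) * (\<integral>\<theta>. e' \<theta> \<partial>torus \<Lambda>) + s * ((\<integral>\<theta>. e \<theta> \<partial>torus \<Lambda>) * (\<integral>\<theta>. f \<theta> * e' \<theta> \<partial>torus \<Lambda>))"
      unfolding integral_mult_right_zero T.integral_tensor(2)[OF mfe(1) bfe(1) me(2) be(2)] T.integral_tensor(2)[OF me(1) be(1) mfe(2) bfe(2)] ..
    finally show ?thesis .
  qed
  have "0 \<le> (\<integral>\<theta>. e \<theta> \<partial>torus \<Lambda>)"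
    by (rule integral_nonneg_AE) (simp add: e_def)
  then have "\<bar>\<integral>\<theta>. f \<theta> * e' \<theta> \<partial>torus \<Lambda>\<bar> * (\<integral>\<theta>. e \<theta> \<partial>torus \<Lambda>) = \<bar>(\<integral>\<theta>. e \<theta> \<partial>torus \<Lambda>) * (\<integral>\<theta>. f \<theta> * e' \<theta> \<partial>torus \<Lambda>)\<bar>"
    by (simp add: abs_mult)
  also have "\<dots> \<le> (\<integral>\<theta>. f \<theta> * e \<theta> \<partial>torus \<Lambda>) * (\<integral>\<theta>. e' \<theta> \<partial>torus \<Lambda>)"
    using key[of 1] key[of "-1"] by (simp add: abs_le_iff)
  finally show ?thesis
    unfolding f_def e_def e'_def .
qed

section \<open>Invariance of the uniform measure on the sphere\<close>

text \<open>Uniqueness of Haar measure by Fubini: integrate \<open>f (y + T x)\<close> over \<open>x\<close> and over \<open>y\<close> in the unit ball, which \<open>T\<close>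
  preserves. (The change of variables theorem of the library needs a well-ordered index type.)\<close>
lemma nn_integral_lborel_orthogonal_transformation:
  fixes T :: "'a::euclidean_space \<Rightarrow> 'a" and f :: "'a \<Rightarrow> ennreal"
  assumes T: "orthogonal_transformation T" and f: "f \<in> borel_measurable borel"
  shows "(\<integral>\<^sup>+x. f (T x) \<partial>lborel) = (\<integral>\<^sup>+x. f x \<partial>lborel)"
proof -
  define B where "B = (ball 0 1 :: 'a set)"
  define b where "b = emeasure lborel B"
  have lin: "linear T" by (rule orthogonal_transformation_linear[OF T])
  have mT: "T \<in> borel_measurable borel"
    by (intro borel_measurable_continuous_onI linear_continuous_on lin[unfolded linear_conv_bounded_linear])
  have "measure lborel B > 0"
    unfolding B_def by (rule content_ball_pos) simp
  then have b: "b \<noteq> 0" "b \<noteq> \<infinity>"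
    using emeasure_lborel_ball_finite[of "0::'a" 1] by (auto simp: b_def B_def measure_def)
  have B: "B \<in> sets lborel" by (simp add: B_def)
  have iB: "indicator B \<in> borel_measurable (borel :: 'a measure)" using B by simp
  have m2: "(\<lambda>p. f (fst p + T (snd p)) * indicator B (fst p)) \<in> borel_measurable (lborel \<Otimes>\<^sub>M lborel)"
    "(\<lambda>p. f (fst p) * indicator B (fst p - T (snd p))) \<in> borel_measurable (lborel \<Otimes>\<^sub>M lborel)"
    using f mT iB by measurable
  have surj: "\<exists>s. y = T s" for y
    using orthogonal_transformation_surj[OF T] by (auto simp: surj_def)
  have "(\<integral>\<^sup>+x. f (T x) \<partial>lborel) * b = (\<integral>\<^sup>+y. (\<integral>\<^sup>+x. f (T x) \<partial>lborel) * indicator B y \<partial>lborel)"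
    unfolding b_def by (rule nn_integral_cmult_indicator[OF B, symmetric])
  also have "\<dots> = (\<integral>\<^sup>+y. \<integral>\<^sup>+x. f (y + T x) * indicator B y \<partial>lborel \<partial>lborel)"
  proof (rule nn_integral_cong)
    fix y :: 'a
    obtain s where s: "y = T s" using surj by blast
    have "(\<integral>\<^sup>+x. f (T x) \<partial>lborel) = (\<integral>\<^sup>+x. f (T (x + s)) \<partial>lborel)"
      by (rule nn_integral_lborel_shift[symmetric]) (rule measurable_compose[OF mT f])
    also have "\<dots> = (\<integral>\<^sup>+x. f (y + T x) \<partial>lborel)"
      by (simp add: s linear_add[OF lin] add.commute)
    finally show "(\<integral>\<^sup>+x. f (T x) \<partial>lborel) * indicator B y = (\<integral>\<^sup>+x. f (y + T x) * indicator B y \<partial>lborel)"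
      by (subst nn_integral_multc) (use f mT in measurable)
  qed
  also have "\<dots> = (\<integral>\<^sup>+x. \<integral>\<^sup>+y. f (y + T x) * indicator B y \<partial>lborel \<partial>lborel)"
    using lborel_pair.Fubini[OF m2(1)] by simp
  also have "\<dots> = (\<integral>\<^sup>+x. \<integral>\<^sup>+y. f y * indicator B (y - T x) \<partial>lborel \<partial>lborel)"
  proof (rule nn_integral_cong)
    fix x :: 'a
    have "(\<lambda>y. f y * indicator B (y - T x)) \<in> borel_measurable borel"
      using f iB by measurable
    from nn_integral_lborel_shift[OF this, of "T x"]
    show "(\<integral>\<^sup>+y. f (y + T x) * indicator B y \<partial>lborel) = (\<integral>\<^sup>+y. f y * indicator B (y - T x) \<partial>lborel)"
      by simp
  qed
  also have "\<dots> = (\<integral>\<^sup>+y. \<integral>\<^sup>+x. f y * indicator B (y - T x) \<partial>lborel \<partial>lborel)"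
    using lborel_pair.Fubini[OF m2(2)] by simp
  also have "\<dots> = (\<integral>\<^sup>+y. f y * b \<partial>lborel)"
  proof (rule nn_integral_cong)
    fix y :: 'a
    obtain s where s: "y = T s" using surj by blast
    have "(indicator B (y - T x) :: ennreal) = indicator B (x + - s)" for x
      using orthogonal_transformation_norm[OF T, of "s - x"] norm_minus_commute[of s x]
      by (simp add: B_def indicator_def s linear_diff[OF lin])
    then have "(\<integral>\<^sup>+x. indicator B (y - T x) \<partial>lborel) = (\<integral>\<^sup>+x. indicator B (x + - s) \<partial>lborel)"
      by (simp only:)
    also have "\<dots> = b"
      using nn_integral_lborel_shift[OF iB, of "- s"] B by (simp add: b_def)
    finally have e: "(\<integral>\<^sup>+x. indicator B (y - T x) \<partial>lborel) = b" .
    have "(\<lambda>x. indicator B (y - T x) :: ennreal) \<in> borel_measurable lborel"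
      using mT iB by measurable
    from nn_integral_cmult[OF this, of "f y"] show "(\<integral>\<^sup>+x. f y * indicator B (y - T x) \<partial>lborel) = f y * b"
      by (simp only: e)
  qed
  also have "\<dots> = (\<integral>\<^sup>+y. f y \<partial>lborel) * b"
    by (rule nn_integral_multc) (use f in simp)
  finally have "b * (\<integral>\<^sup>+x. f (T x) \<partial>lborel) = b * (\<integral>\<^sup>+x. f x \<partial>lborel)"
    by (simp only: mult.commute)
  then show ?thesis
    unfolding ennreal_mult_cancel_left using b by auto
qed

section \<open>The cone measure on the sphere and its symmetries\<close>

abbreviation unit_ball_measure :: "(real^'n) measure" where
  "unit_ball_measure \<equiv> uniform_measure lborel (ball 0 1)"

lemma measurable_radial_projection: "(\<lambda>v::real^'n. v /\<^sub>R norm v) \<in> borel_measurable borel"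
  by (intro borel_measurable_scaleR borel_measurable_inverse borel_measurable_norm) simp_all

lemma sets_unif_sphere [simp]: "sets unif_sphere = sets borel"
  by (simp add: unif_sphere_def)

lemma space_unif_sphere [simp]: "space unif_sphere = UNIV"
  by (simp add: unif_sphere_def)

lemma emeasure_unit_ball: "emeasure lborel (ball 0 1 :: (real^'n) set) \<noteq> 0" "emeasure lborel (ball 0 1 :: (real^'n) set) \<noteq> \<infinity>"
  using content_ball_pos[of 1 "0::real^'n"] emeasure_lborel_ball_finite[of "0::real^'n" 1]
  by (auto simp: measure_def)

lemma prob_space_unif_sphere: "prob_space unif_sphere"
proof -
  interpret prob_space unit_ball_measure
    by (rule prob_space_uniform_measure[OF emeasure_unit_ball])
  show ?thesis
    unfolding unif_sphere_def by (rule prob_space_distr) (simp add: measurable_radial_projection)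
qed

text \<open>Radial projection sends the origin to 0, because \<open>inverse 0 = 0\<close>. The
  origin is a null set, so statements about unit spins hold almost everywhere only.\<close>

lemma AE_unif_sphere_norm: "AE v in unif_sphere. norm v = 1"
proof -
  have "AE v in unit_ball_measure. norm ((v::real^'n) /\<^sub>R norm v) = 1"
  proof (rule AE_uniform_measureI)
    have "AE v in lborel. (v::real^'n) \<noteq> 0"
      by (rule AE_lborel_singleton)
    then show "AE v in lborel. v \<in> ball 0 1 \<longrightarrow> norm ((v::real^'n) /\<^sub>R norm v) = 1"
      by eventually_elim simp
  qed simp
  moreover have "{v \<in> space borel. norm (v::real^'n) = 1} \<in> sets borel"
    by measurable
  ultimately show ?thesis
    unfolding unif_sphere_def by (subst AE_distr_iff) (simp_all add: measurable_radial_projection)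
qed

lemma emeasure_unif_sphere:
  fixes A :: "(real^'n) set"
  assumes "A \<in> sets borel"
  shows "emeasure unif_sphere A
    = (\<integral>\<^sup>+v. indicator A (v /\<^sub>R norm v) * indicator (ball 0 1) v \<partial>lborel) / emeasure lborel (ball 0 1 :: (real^'n) set)"
proof -
  have i: "(\<lambda>v::real^'n. indicator A (v /\<^sub>R norm v) :: ennreal) \<in> borel_measurable borel"
    by (rule measurable_compose[OF measurable_radial_projection]) (use assms in simp)
  have "emeasure unif_sphere A = (\<integral>\<^sup>+v. indicator A v \<partial>unif_sphere)"
    using assms by simp
  also have "\<dots> = (\<integral>\<^sup>+v. indicator A (v /\<^sub>R norm v) \<partial>unit_ball_measure)"
    unfolding unif_sphere_def by (rule nn_integral_distr) (use assms in \<open>simp_all add: measurable_radial_projection\<close>)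
  also have "\<dots> = (\<integral>\<^sup>+v. indicator A (v /\<^sub>R norm v) * indicator (ball 0 1) v \<partial>lborel) / emeasure lborel (ball 0 1 :: (real^'n) set)"
    by (rule nn_integral_uniform_measure) (use i in simp_all)
  finally show ?thesis .
qed

text \<open>An orthogonal map preserves the ball and commutes with the radial projection, so the
  cone measure inherits the invariance of Lebesgue measure.\<close>

lemma distr_unif_sphere_orthogonal_transformation:
  fixes T :: "real^'n \<Rightarrow> real^'n"
  assumes T: "orthogonal_transformation T"
  shows "T \<in> measurable unif_sphere unif_sphere" "distr unif_sphere unif_sphere T = unif_sphere"
proof -
  have mT: "T \<in> borel_measurable borel"
    by (intro borel_measurable_continuous_onI linear_continuous_on
      orthogonal_transformation_linear[OF T, unfolded linear_conv_bounded_linear])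
  then show mT': "T \<in> measurable unif_sphere unif_sphere"
    by (subst measurable_cong_sets[OF sets_unif_sphere sets_unif_sphere])
  show "distr unif_sphere unif_sphere T = unif_sphere"
  proof (rule measure_eqI)
    fix A assume "A \<in> sets (distr unif_sphere unif_sphere T)"
    then have A: "A \<in> sets borel" by simp
    have TA: "T -` A \<in> sets borel"
      using measurable_sets[OF mT A] by simp
    have "(\<lambda>v. indicator A (v /\<^sub>R norm v) * indicator (ball 0 1) v :: ennreal) \<in> borel_measurable borel"
      by (rule borel_measurable_times_ennreal[OF measurable_compose[OF measurable_radial_projection]]) (use A in \<open>auto intro!: borel_measurable_indicator\<close>)
    note e = nn_integral_lborel_orthogonal_transformation[OF T this]
    have "emeasure (distr unif_sphere unif_sphere T) A = emeasure unif_sphere (T -` A)"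
      using emeasure_distr[OF mT', of A] A by simp
    also have "\<dots> = emeasure unif_sphere A"
      unfolding emeasure_unif_sphere[OF A] emeasure_unif_sphere[OF TA] e[symmetric]
      by (simp add: orthogonal_transformation_norm[OF T] orthogonal_transformation_scaleR[OF T] indicator_def vimage_def)
    finally show "emeasure (distr unif_sphere unif_sphere T) A = emeasure unif_sphere A" .
  qed simp
qed

text \<open>Every \<open>R (t, _)\<close> preserves \<open>M2\<close>, so averaging over
  \<open>t\<close> multiplies the integral by the mass of \<open>M1\<close> and changes nothing
  else. This takes the place of a conditional expectation given the orbit.\<close>

lemma (in pair_sigma_finite) orbit_average:
  fixes f :: "'b \<Rightarrow> real"
  assumes fin: "finite_measure M1" and R: "R \<in> measurable (M1 \<Otimes>\<^sub>M M2) M2"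
    and inv: "\<And>t. t \<in> space M1 \<Longrightarrow> distr M2 M2 (\<lambda>s. R (t, s)) = M2"
    and f: "integrable M2 f"
  shows "integrable M2 (\<lambda>s. \<integral>t. f (R (t, s)) \<partial>M1)"
    and "(\<integral>s. (\<integral>t. f (R (t, s)) \<partial>M1) \<partial>M2) = measure M1 (space M1) * (\<integral>s. f s \<partial>M2)"
proof -
  have Rt: "(\<lambda>s. R (t, s)) \<in> measurable M2 M2" if "t \<in> space M1" for t
    by (rule measurable_compose[OF measurable_Pair1'[OF that] R])
  have mf: "f \<in> borel_measurable M2" using f by simp
  have i: "integrable M2 (\<lambda>s. f (R (t, s)))" if t: "t \<in> space M1" for t
    using f integrable_distr[OF Rt[OF t], of f] by (simp add: inv[OF t])
  have e: "(\<integral>s. h (R (t, s)) \<partial>M2) = (\<integral>s. h s \<partial>M2)" if t: "t \<in> space M1" and "h \<in> borel_measurable M2" for t and h :: "'b \<Rightarrow> real"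
    using integral_distr[OF Rt[OF t] that(2)] by (simp add: inv[OF t])
  have int: "integrable (M1 \<Otimes>\<^sub>M M2) (\<lambda>p. f (R p))"
  proof (rule Fubini_integrable)
    show "(\<lambda>p. f (R p)) \<in> borel_measurable (M1 \<Otimes>\<^sub>M M2)"
      by (rule measurable_compose[OF R mf])
    have n: "(\<integral>s. norm (f (R (t, s))) \<partial>M2) = (\<integral>s. norm (f s) \<partial>M2)" if "t \<in> space M1" for t
      by (rule e[OF that measurable_compose[OF mf borel_measurable_norm]])
    show "integrable M1 (\<lambda>t. \<integral>s. norm (f (R (t, s))) \<partial>M2)"
      by (rule iffD2[OF Bochner_Integration.integrable_cong[OF refl n] finite_measure.integrable_const[OF fin]])
    show "AE t in M1. integrable M2 (\<lambda>s. f (R (t, s)))"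
      by (rule AE_I2) (rule i)
  qed
  then have int': "integrable (M1 \<Otimes>\<^sub>M M2) (\<lambda>(t, s). f (R (t, s)))"
    by (simp add: case_prod_beta')
  show "integrable M2 (\<lambda>s. \<integral>t. f (R (t, s)) \<partial>M1)"
    by (rule integrable_snd[OF int'])
  have "(\<integral>s. (\<integral>t. f (R (t, s)) \<partial>M1) \<partial>M2) = (\<integral>t. (\<integral>s. f (R (t, s)) \<partial>M2) \<partial>M1)"
    by (rule Fubini_integral[OF int'])
  also have "\<dots> = (\<integral>t. (\<integral>s. f s \<partial>M2) \<partial>M1)"
    by (rule Bochner_Integration.integral_cong[OF refl e[OF _ mf]])
  also have "\<dots> = measure M1 (space M1) * (\<integral>s. f s \<partial>M2)"
    by simp
  finally show "(\<integral>s. (\<integral>t. f (R (t, s)) \<partial>M1) \<partial>M2) = measure M1 (space M1) * (\<integral>s. f s \<partial>M2)" .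
qed

text \<open>Passes from an inequality on almost every orbit to one between full integrals; the
  masses of \<open>M1\<close> cancel.\<close>

lemma (in pair_sigma_finite) orbit_average_mono:
  fixes f g :: "'b \<Rightarrow> real"
  assumes fin: "finite_measure M1" and pos: "measure M1 (space M1) > 0" and R: "R \<in> measurable (M1 \<Otimes>\<^sub>M M2) M2"
    and inv: "\<And>t. t \<in> space M1 \<Longrightarrow> distr M2 M2 (\<lambda>s. R (t, s)) = M2"
    and f: "integrable M2 f" and g: "integrable M2 g"
    and le: "AE s in M2. \<bar>\<integral>t. f (R (t, s)) \<partial>M1\<bar> \<le> (\<integral>t. g (R (t, s)) \<partial>M1)"
  shows "\<bar>\<integral>s. f s \<partial>M2\<bar> \<le> (\<integral>s. g s \<partial>M2)"
proof -
  note F = orbit_average[OF fin R inv f] and G = orbit_average[OF fin R inv g]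
  have "measure M1 (space M1) * \<bar>\<integral>s. f s \<partial>M2\<bar> = \<bar>\<integral>s. (\<integral>t. f (R (t, s)) \<partial>M1) \<partial>M2\<bar>"
    using pos by (simp add: F(2) abs_mult)
  also have "\<dots> \<le> (\<integral>s. \<bar>\<integral>t. f (R (t, s)) \<partial>M1\<bar> \<partial>M2)"
    by (rule integral_abs_bound)
  also have "\<dots> \<le> (\<integral>s. (\<integral>t. g (R (t, s)) \<partial>M1) \<partial>M2)"
    by (rule integral_mono_AE[OF integrable_abs[OF F(1)] G(1) le])
  also have "\<dots> = measure M1 (space M1) * (\<integral>s. g s \<partial>M2)"
    by (rule G(2))
  finally show ?thesis
    using pos by simp
qed

text \<open>Complex notation turns a planar rotation into multiplication by \<open>cis t\<close>,
  and the planar inner product into the real part of \<open>z * cnj w\<close>.\<close>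

definition plane_part :: "'n \<Rightarrow> 'n \<Rightarrow> real^'n \<Rightarrow> complex" where
  "plane_part a b v = Complex (v $ a) (v $ b)"

definition rest_inner :: "'n::finite \<Rightarrow> 'n \<Rightarrow> real^'n \<Rightarrow> real^'n \<Rightarrow> real" where
  "rest_inner a b v w = (\<Sum>c\<in>UNIV - {a, b}. v $ c * w $ c)"

definition plane_rot :: "'n \<Rightarrow> 'n \<Rightarrow> real \<Rightarrow> real^'n \<Rightarrow> real^'n" where
  "plane_rot a b t v = (\<chi> c. if c = a then cos t * v $ a - sin t * v $ b
                            else if c = b then sin t * v $ a + cos t * v $ b else v $ c)"

lemma inner_plane_rest:
  assumes "a \<noteq> b"
  shows "v \<bullet> w = Re (plane_part a b v * cnj (plane_part a b w)) + rest_inner a b v w"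
proof -
  have "v \<bullet> w = (\<Sum>c\<in>insert a (insert b (UNIV - {a, b})). v $ c * w $ c)"
    unfolding inner_vec_def by (rule sum.cong) auto
  also have "\<dots> = v $ a * w $ a + (v $ b * w $ b + rest_inner a b v w)"
    using assms by (simp add: rest_inner_def)
  finally show ?thesis by (simp add: plane_part_def)
qed

lemma plane_part_rot: "a \<noteq> b \<Longrightarrow> plane_part a b (plane_rot a b t v) = cis t * plane_part a b v"
  by (simp add: plane_part_def plane_rot_def complex_eq_iff add.commute)

lemma rest_inner_rot: "rest_inner a b (plane_rot a b s v) (plane_rot a b t w) = rest_inner a b v w"
  unfolding rest_inner_def by (rule sum.cong) (auto simp: plane_rot_def)

lemma orthogonal_transformation_plane_rot:
  assumes "a \<noteq> b" shows "orthogonal_transformation (plane_rot a b t)"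
proof -
  have "linear (plane_rot a b t)"
    by (rule linearI) (auto simp: plane_rot_def vec_eq_iff algebra_simps)
  moreover have "plane_rot a b t v \<bullet> plane_rot a b t w = v \<bullet> w" for v w
  proof -
    have "cis t * cnj (cis t) = 1"
      by (simp add: cis_cnj cis_mult)
    then have "cis t * z * cnj (cis t * w) = z * cnj w" for z w
      by (metis complex_cnj_mult mult.assoc mult.left_commute mult_1)
    then show ?thesis
      unfolding inner_plane_rest[OF assms] plane_part_rot[OF assms] rest_inner_rot by (simp only:)
  qed
  ultimately show ?thesis by (simp add: orthogonal_transformation_def)
qed

text \<open>The arithmetic-geometric mean inequality bounds both summands by half sums of squares,
  which together make up half of the two squared norms. This trade-off between planar lengths and
  orthogonal parts is what caps the conditional couplings.\<close>

lemma abs_rest_inner_le: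
  assumes "a \<noteq> b" "norm v = 1" "norm w = 1"
  shows "\<bar>rest_inner a b v w\<bar> + cmod (plane_part a b v) * cmod (plane_part a b w) \<le> 1"
proof -
  let ?r = "cmod (plane_part a b v)" and ?s = "cmod (plane_part a b w)"
  have n: "(cmod (plane_part a b u))\<^sup>2 + rest_inner a b u u = 1" if "norm u = 1" for u
    using inner_plane_rest[OF assms(1), of u u] that
    by (simp add: complex_mult_cnj cmod_power2 dot_square_norm)
  have "\<bar>rest_inner a b v w\<bar> \<le> (\<Sum>c\<in>UNIV - {a, b}. \<bar>v $ c * w $ c\<bar>)"
    unfolding rest_inner_def by (rule sum_abs)
  also have "\<dots> \<le> (\<Sum>c\<in>UNIV - {a, b}. (v $ c * v $ c + w $ c * w $ c) / 2)"
  proof (rule sum_mono)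
    fix c
    show "\<bar>v $ c * w $ c\<bar> \<le> (v $ c * v $ c + w $ c * w $ c) / 2"
      using sum_squares_bound[of "\<bar>v $ c\<bar>" "\<bar>w $ c\<bar>"] by (simp add: abs_mult power2_eq_square)
  qed
  also have "\<dots> = (rest_inner a b v v + rest_inner a b w w) / 2"
    by (simp add: rest_inner_def sum.distrib flip: sum_divide_distrib)
  finally show ?thesis
    using n[OF assms(2)] n[OF assms(3)] sum_squares_bound[of ?r ?s] by simp
qed

section \<open>Independent planar rotations of all spins\<close>

definition rotate_all :: "'a set \<Rightarrow> 'n \<Rightarrow> 'n \<Rightarrow> ('a \<Rightarrow> real) \<times> ('a \<Rightarrow> real^'n) \<Rightarrow> ('a \<Rightarrow> real^'n)" where
  "rotate_all \<Lambda> a b p = (\<lambda>x\<in>\<Lambda>. plane_rot a b (fst p x) (snd p x))"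

abbreviation spins :: "'a set \<Rightarrow> ('a \<Rightarrow> real^'n) measure" where
  "spins \<Lambda> \<equiv> PiM \<Lambda> (\<lambda>_. unif_sphere)"

lemma measurable_spin: "x \<in> \<Lambda> \<Longrightarrow> (\<lambda>\<sigma>. \<sigma> x) \<in> borel_measurable (spins \<Lambda>)"
  using measurable_component_singleton[of x \<Lambda> "\<lambda>_. unif_sphere"]
  by (subst (asm) measurable_cong_sets[OF refl sets_unif_sphere])

lemma measurable_spin_component: "x \<in> \<Lambda> \<Longrightarrow> (\<lambda>\<sigma>. \<sigma> x $ c) \<in> borel_measurable (spins \<Lambda>)"
  by (rule measurable_compose[OF measurable_spin]) simp_all

lemma product_prob_space_spins: "product_prob_space (\<lambda>_. unif_sphere)"
  by (rule product_prob_spaceI) (rule prob_space_unif_sphere)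

lemma prob_space_spins: "prob_space (spins \<Lambda>)"
  by (rule prob_space_PiM) (rule prob_space_unif_sphere)

lemma AE_spins_norm:
  assumes "finite \<Lambda>" shows "AE \<sigma> in spins \<Lambda>. \<forall>x\<in>\<Lambda>. norm (\<sigma> x) = 1"
  by (rule AE_finite_allI[OF assms]) (rule AE_PiM_component[OF prob_space_unif_sphere _ AE_unif_sphere_norm])

lemma measurable_plane_rot: "(\<lambda>p. plane_rot a b (fst p) (snd p)) \<in> borel_measurable (borel :: (real \<times> (real^'n)) measure)"
  unfolding plane_rot_def[abs_def]
proof (rule borel_measurable_continuous_onI, rule continuous_on_vec_lambda)
  fix c
  show "continuous_on UNIV (\<lambda>p::real \<times> (real^'n). if c = a then cos (fst p) * snd p $ a - sin (fst p) * snd p $ b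
                            else if c = b then sin (fst p) * snd p $ a + cos (fst p) * snd p $ b else snd p $ c)"
    by (cases "c = a"; cases "c = b"; simp; intro continuous_intros)
qed

lemma measurable_rotate_all: "rotate_all \<Lambda> a b \<in> measurable (torus \<Lambda> \<Otimes>\<^sub>M spins \<Lambda>) (spins \<Lambda>)"
  unfolding rotate_all_def[abs_def]
proof (rule measurable_restrict)
  fix x assume x: "x \<in> \<Lambda>"
  have "(\<lambda>p. (fst p x, snd p x)) \<in> measurable (torus \<Lambda> \<Otimes>\<^sub>M spins \<Lambda>) (borel :: (real \<times> (real^'n)) measure)"
    by (intro borel_measurable_Pair measurable_fst_torus[OF x] measurable_compose[OF measurable_snd measurable_spin[OF x]])
  from measurable_compose[OF this measurable_plane_rot[of a b]]
  show "(\<lambda>p. plane_rot a b (fst p x) (snd p x)) \<in> measurable (torus \<Lambda> \<Otimes>\<^sub>M spins \<Lambda>) unif_sphere"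
    unfolding fst_conv snd_conv by (subst measurable_cong_sets[OF refl sets_unif_sphere])
qed

lemma distr_rotate_all:
  assumes "finite \<Lambda>" "a \<noteq> b"
  shows "distr (spins \<Lambda>) (spins \<Lambda>) (\<lambda>\<sigma>. rotate_all \<Lambda> a b (\<theta>, \<sigma>)) = spins \<Lambda>"
proof -
  interpret product_prob_space "\<lambda>_. unif_sphere" by (rule product_prob_space_spins)
  note o = distr_unif_sphere_orthogonal_transformation[OF orthogonal_transformation_plane_rot[OF assms(2)]]
  show ?thesis
    unfolding rotate_all_def fst_conv snd_conv
    by (rule distr_PiM_componentwise[OF assms(1) o(1) product_sigma_finite_axioms o(2)])
qed

section \<open>Conditioning on the planar angles\<close>

text \<open>In planar polar coordinates this is
  \<open>(r_x * r_y) ^ m * cos (m * (\<phi>_x - \<phi>_y))\<close>, and \<open>plane_size\<close> is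
  its angle-free factor. The vector correlation uses \<open>m = 1\<close>, the tensor correlation
  \<open>m = 2\<close>.\<close>

definition plane_corr :: "'n \<Rightarrow> 'n \<Rightarrow> nat \<Rightarrow> 'a \<Rightarrow> 'a \<Rightarrow> ('a \<Rightarrow> real^'n) \<Rightarrow> real" where
  "plane_corr a b m x y \<sigma> = Re ((plane_part a b (\<sigma> x) * cnj (plane_part a b (\<sigma> y))) ^ m)"

definition plane_size :: "'n \<Rightarrow> 'n \<Rightarrow> nat \<Rightarrow> 'a \<Rightarrow> 'a \<Rightarrow> ('a \<Rightarrow> real^'n) \<Rightarrow> real" where
  "plane_size a b m x y \<sigma> = (cmod (plane_part a b (\<sigma> x)) * cmod (plane_part a b (\<sigma> y))) ^ m"

text \<open>A vanishing planar part is covered as well: its modulus is 0, so the value of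
  \<open>Arg\<close> there is immaterial.\<close>

lemma plane_product_polar:
  "(cis s * plane_part a b v) * cnj (cis t * plane_part a b w)
    = complex_of_real (cmod (plane_part a b v) * cmod (plane_part a b w))
      * cis ((s + Arg (plane_part a b v)) - (t + Arg (plane_part a b w)))"
proof -
  have p: "cis s * z = complex_of_real (cmod z) * cis (s + Arg z)" for s z
    using rcis_cmod_Arg[of z] by (metis rcis_def cis_mult mult.left_commute)
  have c: "cis (u - v) = cis u * cnj (cis v)" for u v
    by (simp add: cis_cnj cis_mult)
  show ?thesis
    unfolding p[of s "plane_part a b v"] p[of t "plane_part a b w"] c by (simp only: complex_cnj_mult complex_cnj_complex_of_real of_real_mult mult_ac)
qed

lemma plane_corr_rotate:
  assumes "a \<noteq> b" "x \<in> \<Lambda>" "y \<in> \<Lambda>"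
  shows "plane_corr a b m x y (rotate_all \<Lambda> a b (\<theta>, \<sigma>))
    = plane_size a b m x y \<sigma> * cos (real m * ((\<theta> x + Arg (plane_part a b (\<sigma> x))) - (\<theta> y + Arg (plane_part a b (\<sigma> y)))))"
  unfolding plane_corr_def plane_size_def rotate_all_def fst_conv snd_conv restrict_apply'[OF assms(2)] restrict_apply'[OF assms(3)]
    plane_part_rot[OF assms(1)] plane_product_polar power_mult_distrib Complex.DeMoivre
  by (simp add: power_mult_distrib flip: of_real_power of_real_mult)

lemma plane_size_rotate:
  assumes "a \<noteq> b" "x \<in> \<Lambda>" "y \<in> \<Lambda>"
  shows "plane_size a b m x y (rotate_all \<Lambda> a b (\<theta>, \<sigma>)) = plane_size a b m x y \<sigma>"
  unfolding plane_size_def rotate_all_def fst_conv snd_conv restrict_apply'[OF assms(2)] restrict_apply'[OF assms(3)]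
    plane_part_rot[OF assms(1)] norm_mult norm_cis mult_1 ..

definition plane_J :: "('a set \<Rightarrow> real) \<Rightarrow> ('a set \<Rightarrow> real) \<Rightarrow> 'n::finite \<Rightarrow> 'n \<Rightarrow> ('a \<Rightarrow> real^'n) \<Rightarrow> 'a \<Rightarrow> 'a \<Rightarrow> real" where
  "plane_J J' K' a b \<sigma> x y = plane_size a b 1 x y \<sigma> * (J' {x,y} + K' {x,y} * rest_inner a b (\<sigma> x) (\<sigma> y))"

definition plane_K :: "('a set \<Rightarrow> real) \<Rightarrow> 'n \<Rightarrow> 'n \<Rightarrow> ('a \<Rightarrow> real^'n) \<Rightarrow> 'a \<Rightarrow> 'a \<Rightarrow> real" where
  "plane_K K' a b \<sigma> x y = K' {x,y} / 4 * (plane_size a b 1 x y \<sigma>)\<^sup>2"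

text \<open>Conditionally on the lengths of the in-plane parts and on the orthogonal parts of the spins,
  the in-plane angles form a generalized \<open>XY\<close> model.\<close>
lemma H_iso_rotate:
  fixes \<sigma> :: "'a \<Rightarrow> real^'n"
  assumes ab: "a \<noteq> b"
  shows "\<exists>c. \<forall>\<theta>. H_iso \<Lambda> J' K' (rotate_all \<Lambda> a b (\<theta>, \<sigma>))
    = c + XY_energy \<Lambda> (plane_J J' K' a b \<sigma>) (plane_K K' a b \<sigma>) (\<lambda>x. \<theta> x + Arg (plane_part a b (\<sigma> x)))"
proof -
  let ?p = "\<lambda>x y. plane_size a b 1 x y \<sigma>" and ?s = "\<lambda>x y. rest_inner a b (\<sigma> x) (\<sigma> y)"
  let ?\<phi> = "\<lambda>\<theta> x. \<theta> x + Arg (plane_part a b (\<sigma> x))"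
  let ?c = "\<lambda>x y. J' {x,y} * ?s x y + K' {x,y} / 2 * (?s x y)\<^sup>2 + K' {x,y} / 4 * (?p x y)\<^sup>2"
  have inner: "rotate_all \<Lambda> a b (\<theta>, \<sigma>) x \<bullet> rotate_all \<Lambda> a b (\<theta>, \<sigma>) y = ?p x y * cos (?\<phi> \<theta> x - ?\<phi> \<theta> y) + ?s x y"
    if "x \<in> \<Lambda>" "y \<in> \<Lambda>" for x y \<theta>
    using plane_corr_rotate[OF ab that, of 1 \<theta> \<sigma>]
    unfolding inner_plane_rest[OF ab] plane_corr_def power_one_right of_nat_1 mult_1
    using that by (simp add: rotate_all_def rest_inner_rot)
  \<comment> \<open>The cross term \<open>k * p * s * cos u\<close> joins the vector coupling, and
    the double angle formula splits \<open>k / 2 * p^2 * (cos u)^2\<close> into an angle-free part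
    and the quarter coupling of \<open>cos (2 * u)\<close>.\<close>
  have alg: "j * (p * cos u + s) + k / 2 * (p * cos u + s)\<^sup>2
    = (j * s + k / 2 * s\<^sup>2 + k / 4 * p\<^sup>2) + (p * (j + k * s) * cos u + k / 4 * p\<^sup>2 * cos (2 * u))" for j k p s u :: real
    unfolding cos_double_cos by (simp add: power2_eq_square field_simps)
  have "H_iso \<Lambda> J' K' (rotate_all \<Lambda> a b (\<theta>, \<sigma>))
    = bond_sum \<Lambda> ?c + XY_energy \<Lambda> (plane_J J' K' a b \<sigma>) (plane_K K' a b \<sigma>) (?\<phi> \<theta>)" for \<theta>
    unfolding H_iso_def XY_energy_def bond_sum_def case_prod_unfold add_divide_distrib[symmetric] sum.distrib[symmetric] plane_J_def plane_K_def
    by (intro arg_cong[where f="\<lambda>s. s / 2"] sum.cong refl) (simp only: inner alg mem_Collect_eq)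
  then show ?thesis by blast
qed

text \<open>Origin of the two cases in the hypothesis on \<open>J\<close>. With
  \<open>\<bar>s\<bar> \<le> 1 - p\<close> the bound is the concave quadratic
  \<open>p * (\<bar>j\<bar> + \<bar>k\<bar> * (1 - p))\<close>, whose vertex
  \<open>(\<bar>j\<bar> + \<bar>k\<bar>) / (2 * \<bar>k\<bar>)\<close> lies below 1 precisely if
  \<open>\<bar>k\<bar> > \<bar>j\<bar>\<close>. Otherwise the maximum on the unit interval is
  \<open>\<bar>j\<bar>\<close>, taken at \<open>p = 1\<close>.\<close>

lemma coupling_bound:
  fixes p s j k :: real
  assumes p: "0 \<le> p" "\<bar>s\<bar> + p \<le> 1"
  shows "\<bar>p * (j + k * s)\<bar> \<le> (if \<bar>k\<bar> \<le> \<bar>j\<bar> then \<bar>j\<bar> else \<bar>k\<bar> / 4 * (1 + \<bar>j\<bar> / \<bar>k\<bar>)\<^sup>2)"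
proof -
  have "\<bar>j + k * s\<bar> \<le> \<bar>j\<bar> + \<bar>k\<bar> * (1 - p)"
    using p by (intro order_trans[OF abs_triangle_ineq]) (auto simp: abs_mult intro!: mult_left_mono)
  then have "\<bar>p * (j + k * s)\<bar> \<le> p * (\<bar>j\<bar> + \<bar>k\<bar> * (1 - p))"
    using p by (simp add: abs_mult mult_left_mono)
  also have "\<dots> \<le> (if \<bar>k\<bar> \<le> \<bar>j\<bar> then \<bar>j\<bar> else \<bar>k\<bar> / 4 * (1 + \<bar>j\<bar> / \<bar>k\<bar>)\<^sup>2)"
  proof (cases "\<bar>k\<bar> \<le> \<bar>j\<bar>")
    case True
    have "p * \<bar>k\<bar> \<le> 1 * \<bar>j\<bar>"
      using p True by (intro mult_mono) auto
    \<comment> \<open>This product is the gap \<open>\<bar>j\<bar> - p * (\<bar>j\<bar> +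
      \<bar>k\<bar> * (1 - p))\<close>.\<close>
    then have "0 \<le> (1 - p) * (\<bar>j\<bar> - p * \<bar>k\<bar>)"
      using p by (intro mult_nonneg_nonneg) auto
    then show ?thesis using True by (simp add: algebra_simps)
  next
    case False
    then have k: "\<bar>k\<bar> > 0" by linarith
    \<comment> \<open>Completing the square around the vertex.\<close>
    have "K / 4 * (1 + L / K)\<^sup>2 - p * (L + K * (1 - p)) = (2 * K * p - (K + L))\<^sup>2 / (4 * K)" if "K > 0" for K L
      using that by (simp add: field_simps power2_eq_square)
    from this[OF k, of "\<bar>j\<bar>"] have "\<bar>k\<bar> / 4 * (1 + \<bar>j\<bar> / \<bar>k\<bar>)\<^sup>2 - p * (\<bar>j\<bar> + \<bar>k\<bar> * (1 - p)) = (2 * \<bar>k\<bar> * p - (\<bar>k\<bar> + \<bar>j\<bar>))\<^sup>2 / (4 * \<bar>k\<bar>)"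
      .
    also have "\<dots> \<ge> 0" using k by simp
    finally show ?thesis using False by simp
  qed
  finally show ?thesis .
qed

text \<open>Removes the initial arguments of the planar parts, which merely move the origin of each
  angle. At \<open>m = 0\<close> it does the same for the partition function.\<close>

lemma integral_XY_shift:
  assumes \<Lambda>: "finite \<Lambda>" and xy: "x \<in> \<Lambda>" "y \<in> \<Lambda>"
  shows "(\<integral>\<theta>. cos (real m * ((\<theta> x + \<phi> x) - (\<theta> y + \<phi> y))) * exp (XY_energy \<Lambda> A B (\<lambda>x. \<theta> x + \<phi> x)) \<partial>torus \<Lambda>)
    = (\<integral>\<theta>. cos (real m * (\<theta> x - \<theta> y)) * exp (XY_energy \<Lambda> A B \<theta>) \<partial>torus \<Lambda>)"
proof -
  define h where "h = (\<lambda>\<zeta>. Re ((\<zeta> x * cnj (\<zeta> y)) ^ m) * exp (circle_energy \<Lambda> A B \<zeta>))"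
  have h: "h \<in> borel_measurable (PiM \<Lambda> (\<lambda>_. borel))"
    unfolding h_def by (intro borel_measurable_times measurable_Re_power[OF xy] measurable_compose[OF measurable_circle_energy borel_measurable_exp])
  have h_cis: "h (\<lambda>x\<in>\<Lambda>. cis (g x)) = cos (real m * (g x - g y)) * exp (XY_energy \<Lambda> A B g)" for g
    unfolding h_def circle_energy_cis restrict_apply'[OF xy(1)] restrict_apply'[OF xy(2)] cis_times_cnj cis.sel ..
  show ?thesis
    using integral_torus_shift[OF \<Lambda> h, of \<phi>] unfolding h_cis .
qed

lemma gibbs_expect_XY:
  "expect_XY \<Lambda> J K f = (\<integral>\<theta>. f \<theta> * exp (XY_energy \<Lambda> (\<lambda>x y. J {x,y}) (\<lambda>x y. K {x,y}) \<theta>) \<partial>torus \<Lambda>)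
     / (\<integral>\<theta>. exp (XY_energy \<Lambda> (\<lambda>x y. J {x,y}) (\<lambda>x y. K {x,y}) \<theta>) \<partial>torus \<Lambda>)"
  unfolding expect_XY_def gibbs_expect_def H_XY_def XY_energy_def ..

lemma integral_exp_pos:
  assumes "finite_measure M" "measure M (space M) > 0" and H: "H \<in> borel_measurable M" and b: "AE x in M. \<bar>H x\<bar> \<le> C"
  shows "integrable M (\<lambda>x. exp (H x :: real))" "0 < (\<integral>x. exp (H x) \<partial>M)"
proof -
  interpret finite_measure M by fact
  show i: "integrable M (\<lambda>x. exp (H x :: real))"
  proof (rule integrable_const_bound[where B="exp C"])
    show "AE x in M. norm (exp (H x)) \<le> exp C"
      using b by eventually_elim simp
  qed (rule measurable_compose[OF H borel_measurable_exp])
  have "0 < exp (- C) * measure M (space M)"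
    using assms(2) by simp
  also have "\<dots> = (\<integral>x. exp (- C) \<partial>M)" by simp
  also have "\<dots> \<le> (\<integral>x. exp (H x) \<partial>M)"
  proof (rule integral_mono_AE[OF integrable_const i])
    show "AE x in M. exp (- C) \<le> exp (H x)"
      using b by eventually_elim simp
  qed
  finally show "0 < (\<integral>x. exp (H x) \<partial>M)" .
qed

lemma XY_partition_pos:
  assumes \<Lambda>: "finite \<Lambda>"
  shows "integrable (torus \<Lambda>) (\<lambda>\<theta>. exp (XY_energy \<Lambda> A B \<theta>))" "0 < (\<integral>\<theta>. exp (XY_energy \<Lambda> A B \<theta>) \<partial>torus \<Lambda>)"
proof -
  obtain C where C: "\<And>\<theta>. \<bar>XY_energy \<Lambda> A B \<theta>\<bar> \<le> C" using XY_energy_bounded by metis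
  have "0 < measure (torus \<Lambda>) (space (torus \<Lambda>))" by (simp only: measure_torus[OF \<Lambda>]) simp
  from integral_exp_pos[OF finite_measure_torus[OF \<Lambda>] this measurable_XY_energy AE_I2[OF C]]
  show "integrable (torus \<Lambda>) (\<lambda>\<theta>. exp (XY_energy \<Lambda> A B \<theta>))" "0 < (\<integral>\<theta>. exp (XY_energy \<Lambda> A B \<theta>) \<partial>torus \<Lambda>)" .
qed

section \<open>Measurability and integrability for Gibbs weights on spins\<close>

lemma measurable_spin_inner: "x \<in> \<Lambda> \<Longrightarrow> y \<in> \<Lambda> \<Longrightarrow> (\<lambda>\<sigma>. \<sigma> x \<bullet> \<sigma> y) \<in> borel_measurable (spins \<Lambda>)"
  by (intro borel_measurable_inner measurable_spin)

lemma measurable_H_iso: "H_iso \<Lambda> J' K' \<in> borel_measurable (spins \<Lambda>)"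
proof -
  have "(\<lambda>\<sigma>. J' {x,y} * (\<sigma> x \<bullet> \<sigma> y) + K' {x,y} / 2 * (\<sigma> x \<bullet> \<sigma> y)\<^sup>2) \<in> borel_measurable (spins \<Lambda>)"
    if "x \<in> \<Lambda>" "y \<in> \<Lambda>" for x y
    by (intro borel_measurable_add borel_measurable_times borel_measurable_const borel_measurable_power measurable_spin_inner that)
  then show ?thesis
    unfolding H_iso_def[abs_def] bond_sum_def case_prod_unfold
    by (intro borel_measurable_divide borel_measurable_sum borel_measurable_const) blast
qed

lemma abs_inner_le_1: "norm v = 1 \<Longrightarrow> norm w = 1 \<Longrightarrow> \<bar>v \<bullet> w\<bar> \<le> 1"
  using Cauchy_Schwarz_ineq2[of v w] by simp

lemma H_iso_bounded: "\<exists>C. \<forall>\<sigma>. (\<forall>x\<in>\<Lambda>. norm (\<sigma> x) = 1) \<longrightarrow> \<bar>H_iso \<Lambda> J' K' \<sigma>\<bar> \<le> C"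
proof -
  have *: "\<bar>a * t + b / 2 * t\<^sup>2\<bar> \<le> \<bar>a\<bar> + \<bar>b / 2\<bar>" if "\<bar>t\<bar> \<le> 1" for a b t :: real
    using mult_left_mono[OF that, of "\<bar>a\<bar>"] mult_left_mono[of "t\<^sup>2" 1 "\<bar>b / 2\<bar>"] that
      abs_triangle_ineq[of "a * t" "b / 2 * t\<^sup>2"] by (simp add: abs_mult abs_square_le_1)
  have "\<bar>H_iso \<Lambda> J' K' \<sigma>\<bar> \<le> bond_sum \<Lambda> (\<lambda>x y. \<bar>J' {x,y}\<bar> + \<bar>K' {x,y} / 2\<bar>)" if "\<forall>x\<in>\<Lambda>. norm (\<sigma> x) = 1" for \<sigma>
    unfolding H_iso_def bond_sum_def case_prod_unfold abs_divide abs_numeral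
    by (rule divide_right_mono[OF order_trans[OF sum_abs sum_mono[OF *[unfolded abs_divide abs_numeral]]]])
       (auto intro!: abs_inner_le_1 that[rule_format])
  then show ?thesis by blast
qed

lemma
  fixes f :: "('a \<Rightarrow> real^'n) \<Rightarrow> real"
  assumes \<Lambda>: "finite \<Lambda>"
  shows spins_partition_pos: "0 < (\<integral>\<sigma>. exp (H_iso \<Lambda> J' K' (\<sigma> :: 'a \<Rightarrow> real^'n)) \<partial>spins \<Lambda>)"
    and integrable_spins: "f \<in> borel_measurable (spins \<Lambda>) \<Longrightarrow> (\<And>\<sigma>. (\<forall>x\<in>\<Lambda>. norm (\<sigma> x) = 1) \<Longrightarrow> \<bar>f \<sigma>\<bar> \<le> D) \<Longrightarrow>
      integrable (spins \<Lambda>) (\<lambda>\<sigma>. f \<sigma> * exp (H_iso \<Lambda> J' K' \<sigma>))"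
proof -
  interpret prob_space "spins \<Lambda> :: ('a \<Rightarrow> real^'n) measure" by (rule prob_space_spins)
  obtain C where C: "\<And>\<sigma>::'a \<Rightarrow> real^'n. (\<forall>x\<in>\<Lambda>. norm (\<sigma> x) = 1) \<Longrightarrow> \<bar>H_iso \<Lambda> J' K' \<sigma>\<bar> \<le> C"
    using H_iso_bounded by metis
  have AE: "AE \<sigma> in spins \<Lambda>. \<bar>H_iso \<Lambda> J' K' (\<sigma> :: 'a \<Rightarrow> real^'n)\<bar> \<le> C"
    using AE_spins_norm[OF \<Lambda>] by eventually_elim (rule C)
  show "0 < (\<integral>\<sigma>. exp (H_iso \<Lambda> J' K' (\<sigma> :: 'a \<Rightarrow> real^'n)) \<partial>spins \<Lambda>)"
    by (rule integral_exp_pos(2)[OF finite_measure_axioms _ measurable_H_iso AE]) (simp add: prob_space)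
  assume f: "f \<in> borel_measurable (spins \<Lambda>)" "\<And>\<sigma>. (\<forall>x\<in>\<Lambda>. norm (\<sigma> x) = 1) \<Longrightarrow> \<bar>f \<sigma>\<bar> \<le> D"
  show "integrable (spins \<Lambda>) (\<lambda>\<sigma>. f \<sigma> * exp (H_iso \<Lambda> J' K' \<sigma>))"
  proof (rule integrable_const_bound[where B="D * exp C"])
    show "(\<lambda>\<sigma>. f \<sigma> * exp (H_iso \<Lambda> J' K' \<sigma>)) \<in> borel_measurable (spins \<Lambda>)"
      by (intro borel_measurable_times f(1) measurable_compose[OF measurable_H_iso borel_measurable_exp])
    show "AE \<sigma> in spins \<Lambda>. norm (f \<sigma> * exp (H_iso \<Lambda> J' K' \<sigma>)) \<le> D * exp C"
      using AE_spins_norm[OF \<Lambda>]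
    proof eventually_elim
      case (elim \<sigma>)
      have "\<bar>f \<sigma>\<bar> * exp (H_iso \<Lambda> J' K' \<sigma>) \<le> D * exp C"
        using C[OF elim] by (intro mult_mono f(2)[OF elim] order_trans[OF abs_ge_zero f(2)[OF elim]]) auto
      then show ?case by (simp add: abs_mult)
    qed
  qed
qed

lemma plane_size_le_1:
  assumes "a \<noteq> b" "norm (\<sigma> x) = 1" "norm (\<sigma> y) = 1"
  shows "plane_size a b m x y \<sigma> \<le> 1"
  unfolding plane_size_def using abs_rest_inner_le[OF assms] by (intro power_le_one) auto

lemma plane_size_nonneg: "0 \<le> plane_size a b m x y \<sigma>"
  by (simp add: plane_size_def)

lemma abs_plane_corr_le: "\<bar>plane_corr a b m x y \<sigma>\<bar> \<le> plane_size a b m x y \<sigma>"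
  unfolding plane_corr_def plane_size_def
  using abs_Re_le_cmod[of "(plane_part a b (\<sigma> x) * cnj (plane_part a b (\<sigma> y))) ^ m"] by (simp add: norm_power norm_mult)

lemma measurable_plane_part: "x \<in> \<Lambda> \<Longrightarrow> (\<lambda>\<sigma>. plane_part a b (\<sigma> x)) \<in> borel_measurable (spins \<Lambda>)"
proof -
  assume x: "x \<in> \<Lambda>"
  have "plane_part a b \<in> borel_measurable borel"
    unfolding plane_part_def[abs_def] complex_eq complex.sel
    by (intro borel_measurable_continuous_onI continuous_intros)
  from measurable_compose[OF measurable_spin[OF x] this] show ?thesis .
qed

lemma
  assumes xy: "x \<in> \<Lambda>" "y \<in> \<Lambda>"
  shows measurable_plane_corr: "plane_corr a b m x y \<in> borel_measurable (spins \<Lambda>)"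
    and measurable_plane_size: "plane_size a b m x y \<in> borel_measurable (spins \<Lambda>)"
proof -
  have p: "(\<lambda>\<sigma>. (plane_part a b (\<sigma> x), plane_part a b (\<sigma> y))) \<in> measurable (spins \<Lambda>) (borel :: (complex \<times> complex) measure)"
    by (intro borel_measurable_Pair measurable_plane_part xy)
  have "(\<lambda>p::complex \<times> complex. Re ((fst p * cnj (snd p)) ^ m)) \<in> borel_measurable borel"
    by (intro borel_measurable_continuous_onI continuous_intros)
  from measurable_compose[OF p this] show "plane_corr a b m x y \<in> borel_measurable (spins \<Lambda>)"
    unfolding plane_corr_def[abs_def] fst_conv snd_conv .
  have "(\<lambda>p::complex \<times> complex. (cmod (fst p) * cmod (snd p)) ^ m) \<in> borel_measurable borel"
    by (intro borel_measurable_continuous_onI continuous_intros)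
  from measurable_compose[OF p this] show "plane_size a b m x y \<in> borel_measurable (spins \<Lambda>)"
    unfolding plane_size_def[abs_def] fst_conv snd_conv .
qed

lemma
  assumes \<Lambda>: "finite \<Lambda>" and ab: "a \<noteq> b" and xy: "x \<in> \<Lambda>" "y \<in> \<Lambda>"
  shows integrable_plane_corr: "integrable (spins \<Lambda>) (\<lambda>\<sigma>. plane_corr a b m x y \<sigma> * exp (H_iso \<Lambda> J' K' \<sigma>))"
    and integrable_plane_size: "integrable (spins \<Lambda>) (\<lambda>\<sigma>. plane_size a b m x y \<sigma> * exp (H_iso \<Lambda> J' K' \<sigma>))"
proof -
  have s: "\<bar>plane_size a b m x y \<sigma>\<bar> \<le> 1" if "\<forall>x\<in>\<Lambda>. norm (\<sigma> x) = 1" for \<sigma>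
    using plane_size_le_1[OF ab, of \<sigma> x y m] that xy plane_size_nonneg[of a b m x y \<sigma>] by simp
  then have c: "\<bar>plane_corr a b m x y \<sigma>\<bar> \<le> 1" if "\<forall>x\<in>\<Lambda>. norm (\<sigma> x) = 1" for \<sigma>
    using abs_plane_corr_le[of a b m x y \<sigma>] that by force
  show "integrable (spins \<Lambda>) (\<lambda>\<sigma>. plane_corr a b m x y \<sigma> * exp (H_iso \<Lambda> J' K' \<sigma>))"
    by (rule integrable_spins[OF \<Lambda> measurable_plane_corr[OF xy] c])
  show "integrable (spins \<Lambda>) (\<lambda>\<sigma>. plane_size a b m x y \<sigma> * exp (H_iso \<Lambda> J' K' \<sigma>))"
    by (rule integrable_spins[OF \<Lambda> measurable_plane_size[OF xy] s])
qed

text \<open>On one orbit both integrals carry the factor \<open>plane_size * exp c\<close>, with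
  \<open>c\<close> the angle-free energy. Only a ratio of angle integrals depends on the conditional
  couplings, and the model \<open>J, K\<close> bounds it by one constant for all orbits, so the
  bound survives integration with the varying weights.\<close>

lemma plane_comparison:
  fixes a b :: "'n::finite" and \<Lambda> :: "'a set"
  assumes \<Lambda>: "finite \<Lambda>" and ab: "a \<noteq> b" and xy: "x \<in> \<Lambda>" "y \<in> \<Lambda>"
    and hJ: "\<And>u v. u \<in> \<Lambda> \<Longrightarrow> v \<in> \<Lambda> \<Longrightarrow> u \<noteq> v \<Longrightarrow>
       (if \<bar>K' {u,v}\<bar> \<le> \<bar>J' {u,v}\<bar> then \<bar>J' {u,v}\<bar>
        else \<bar>K' {u,v}\<bar> / 4 * (1 + \<bar>J' {u,v}\<bar> / \<bar>K' {u,v}\<bar>)^2) \<le> J {u,v}"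
    and hK: "\<And>u v. u \<in> \<Lambda> \<Longrightarrow> v \<in> \<Lambda> \<Longrightarrow> u \<noteq> v \<Longrightarrow> \<bar>K' {u,v}\<bar> / 4 \<le> K {u,v}"
  shows "\<bar>\<integral>\<sigma>. plane_corr a b m x y \<sigma> * exp (H_iso \<Lambda> J' K' \<sigma>) \<partial>spins \<Lambda>\<bar>
    \<le> expect_XY \<Lambda> J K (\<lambda>\<theta>. cos (real m * (\<theta> x - \<theta> y))) * (\<integral>\<sigma>. plane_size a b m x y \<sigma> * exp (H_iso \<Lambda> J' K' \<sigma>) \<partial>spins \<Lambda>)"
proof -
  interpret T: finite_measure "torus \<Lambda>" by (rule finite_measure_torus[OF \<Lambda>])
  interpret S: prob_space "spins \<Lambda> :: ('a \<Rightarrow> real^'n) measure" by (rule prob_space_spins)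
  interpret P: pair_sigma_finite "torus \<Lambda>" "spins \<Lambda> :: ('a \<Rightarrow> real^'n) measure" ..
  define \<gamma> where "\<gamma> = expect_XY \<Lambda> J K (\<lambda>\<theta>. cos (real m * (\<theta> x - \<theta> y)))"
  have pos: "0 < measure (torus \<Lambda>) (space (torus \<Lambda>))" by (simp only: measure_torus[OF \<Lambda>]) simp
  have cond: "\<bar>\<integral>\<theta>. plane_corr a b m x y (rotate_all \<Lambda> a b (\<theta>, \<sigma>)) * exp (H_iso \<Lambda> J' K' (rotate_all \<Lambda> a b (\<theta>, \<sigma>))) \<partial>torus \<Lambda>\<bar>
    \<le> (\<integral>\<theta>. \<gamma> * (plane_size a b m x y (rotate_all \<Lambda> a b (\<theta>, \<sigma>)) * exp (H_iso \<Lambda> J' K' (rotate_all \<Lambda> a b (\<theta>, \<sigma>)))) \<partial>torus \<Lambda>)"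
    if \<sigma>: "\<forall>x\<in>\<Lambda>. norm (\<sigma> x) = 1" for \<sigma> :: "'a \<Rightarrow> real^'n"
  proof -
    let ?A = "plane_J J' K' a b \<sigma>" and ?B = "plane_K K' a b \<sigma>" and ?\<phi> = "\<lambda>x. Arg (plane_part a b (\<sigma> x))"
    let ?E = "XY_energy \<Lambda> (\<lambda>x y. J {x,y}) (\<lambda>x y. K {x,y})"
    \<comment> \<open>\<open>?C 0\<close> is the partition function of the conditional
      model.\<close>
    let ?C = "\<lambda>m. \<integral>\<theta>. cos (real m * (\<theta> x - \<theta> y)) * exp (XY_energy \<Lambda> ?A ?B \<theta>) \<partial>torus \<Lambda>"
    obtain c where c: "\<And>\<theta>. H_iso \<Lambda> J' K' (rotate_all \<Lambda> a b (\<theta>, \<sigma>)) = c + XY_energy \<Lambda> ?A ?B (\<lambda>x. \<theta> x + ?\<phi> x)"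
      using H_iso_rotate[OF ab, of \<Lambda> J' K' \<sigma>] by blast
    have A: "\<bar>?A u v\<bar> \<le> J {u,v}" if "u \<in> \<Lambda>" "v \<in> \<Lambda>" "u \<noteq> v" for u v
      unfolding plane_J_def
      by (rule order_trans[OF coupling_bound hJ[OF that]])
         (use abs_rest_inner_le[OF ab, of "\<sigma> u" "\<sigma> v"] \<sigma> that in \<open>simp_all add: plane_size_def\<close>)
    have B: "\<bar>?B u v\<bar> \<le> K {u,v}" if "u \<in> \<Lambda>" "v \<in> \<Lambda>" "u \<noteq> v" for u v
    proof -
      have "(plane_size a b 1 u v \<sigma>)\<^sup>2 \<le> 1"
        using plane_size_le_1[OF ab, of \<sigma> u v 1] \<sigma> that by (intro power_le_one plane_size_nonneg) auto
      then have "\<bar>?B u v\<bar> \<le> \<bar>K' {u,v}\<bar> / 4 * 1"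
        unfolding plane_K_def abs_mult by (intro mult_mono) auto
      then show ?thesis using hK[OF that] by simp
    qed
    have g: "\<gamma> = (\<integral>\<theta>. cos (real m * (\<theta> x - \<theta> y)) * exp (?E \<theta>) \<partial>torus \<Lambda>) / (\<integral>\<theta>. exp (?E \<theta>) \<partial>torus \<Lambda>)"
      unfolding \<gamma>_def gibbs_expect_XY ..
    have cmp: "\<bar>?C m\<bar> \<le> \<gamma> * ?C 0"
      using XY_comparison[where A'="?A" and B'="?B" and A="\<lambda>x y. J {x,y}" and B="\<lambda>x y. K {x,y}" and m=m, OF \<Lambda> xy A B] XY_partition_pos(2)[OF \<Lambda>, of "\<lambda>x y. J {x,y}" "\<lambda>x y. K {x,y}"]
      unfolding g by (simp add: field_simps)
    have f: "(\<integral>\<theta>. plane_corr a b m x y (rotate_all \<Lambda> a b (\<theta>, \<sigma>)) * exp (H_iso \<Lambda> J' K' (rotate_all \<Lambda> a b (\<theta>, \<sigma>))) \<partial>torus \<Lambda>)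
      = plane_size a b m x y \<sigma> * exp c * ?C m"
      unfolding plane_corr_rotate[OF ab xy] c exp_add integral_XY_shift[OF \<Lambda> xy, of m ?\<phi>, symmetric] integral_mult_right_zero[symmetric]
      by (simp add: mult_ac)
    have "(\<integral>\<theta>. plane_size a b m x y (rotate_all \<Lambda> a b (\<theta>, \<sigma>)) * exp (H_iso \<Lambda> J' K' (rotate_all \<Lambda> a b (\<theta>, \<sigma>))) \<partial>torus \<Lambda>)
      = plane_size a b m x y \<sigma> * exp c * ?C 0"
      unfolding plane_size_rotate[OF ab xy] c exp_add integral_XY_shift[OF \<Lambda> xy, of 0 ?\<phi>, symmetric] integral_mult_right_zero[symmetric]
      by (simp add: mult_ac)
    then show ?thesis
      unfolding f integral_mult_right_zero
      using mult_left_mono[OF cmp, of "plane_size a b m x y \<sigma> * exp c"] plane_size_nonneg[of a b m x y \<sigma>]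
      by (simp add: abs_mult mult_ac)
  qed
  have "\<bar>\<integral>\<sigma>. plane_corr a b m x y \<sigma> * exp (H_iso \<Lambda> J' K' \<sigma>) \<partial>spins \<Lambda>\<bar>
    \<le> (\<integral>\<sigma>. \<gamma> * (plane_size a b m x y \<sigma> * exp (H_iso \<Lambda> J' K' \<sigma>)) \<partial>spins \<Lambda>)"
  proof (rule P.orbit_average_mono[OF T.finite_measure_axioms pos measurable_rotate_all distr_rotate_all[OF \<Lambda> ab]
      integrable_plane_corr[OF \<Lambda> ab xy] integrable_mult_right[OF integrable_plane_size[OF \<Lambda> ab xy]]])
    show "AE \<sigma> in spins \<Lambda>. \<bar>\<integral>\<theta>. plane_corr a b m x y (rotate_all \<Lambda> a b (\<theta>, \<sigma>)) * exp (H_iso \<Lambda> J' K' (rotate_all \<Lambda> a b (\<theta>, \<sigma>))) \<partial>torus \<Lambda>\<bar>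
    \<le> (\<integral>\<theta>. \<gamma> * (plane_size a b m x y (rotate_all \<Lambda> a b (\<theta>, \<sigma>)) * exp (H_iso \<Lambda> J' K' (rotate_all \<Lambda> a b (\<theta>, \<sigma>)))) \<partial>torus \<Lambda>)"
      using AE_spins_norm[OF \<Lambda>] by eventually_elim (rule cond)
  qed
  then show ?thesis
    unfolding integral_mult_right_zero \<gamma>_def .
qed

section \<open>Summation over the coordinate planes\<close>

text \<open>Every coordinate plane occurs twice, as \<open>(a, b)\<close> and \<open>(b, a)\<close>.
  Both sides of the comparison are summed in this way, and the double sums over all pairs
  factor.\<close>

lemma sum_distinct_pairs:
  fixes F :: "'n::finite \<Rightarrow> 'n \<Rightarrow> real"
  shows "(\<Sum>p | fst p \<noteq> snd p. F (fst p) (snd p)) = (\<Sum>a\<in>UNIV. \<Sum>b\<in>UNIV. F a b) - (\<Sum>a\<in>UNIV. F a a)"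
proof -
  have "(\<Sum>a\<in>UNIV. \<Sum>b\<in>UNIV. F a b) = (\<Sum>p\<in>UNIV. F (fst p) (snd p))"
    by (simp add: sum.cartesian_product case_prod_unfold)
  also have "\<dots> = (\<Sum>p\<in>{p. fst p \<noteq> snd p} \<union> range (\<lambda>a. (a, a)). F (fst p) (snd p))"
    by (rule sum.cong) auto
  also have "\<dots> = (\<Sum>p | fst p \<noteq> snd p. F (fst p) (snd p)) + (\<Sum>p\<in>range (\<lambda>a. (a, a)). F (fst p) (snd p))"
    by (rule sum.union_disjoint) auto
  also have "(\<Sum>p\<in>range (\<lambda>a. (a, a)). F (fst p) (snd p)) = (\<Sum>a\<in>UNIV. F a a)"
    by (subst sum.reindex) (auto simp: inj_on_def)
  finally show ?thesis by simp
qed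

lemma sum_sum_mult: "(\<Sum>a\<in>A. \<Sum>b\<in>B. f a * g b :: real) = sum f A * sum g B"
  by (simp add: sum_product)

lemma sum_sum_left: "(\<Sum>a\<in>A. \<Sum>b\<in>B. f a :: real) = real (card B) * sum f A"
  by (simp add: sum_distrib_left)

text \<open>The part of the \<open>m = 2\<close> sums that depends on the choice of basis.\<close>

definition diag_corr :: "'a \<Rightarrow> 'a \<Rightarrow> ('a \<Rightarrow> real^'n) \<Rightarrow> real" where
  "diag_corr x y \<sigma> = (\<Sum>a\<in>UNIV. (\<sigma> x $ a)\<^sup>2 * (\<sigma> y $ a)\<^sup>2)"

text \<open>\<open>re_corr\<close> and \<open>im_corr\<close> split the \<open>m = 2\<close>
  correlation into two terms which a common turn by \<pi>/4 exchanges, since it multiplies the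
  squared planar parts by the imaginary unit.\<close>

definition re_corr :: "'n \<Rightarrow> 'n \<Rightarrow> 'a \<Rightarrow> 'a \<Rightarrow> ('a \<Rightarrow> real^'n) \<Rightarrow> real" where
  "re_corr a b x y \<sigma> = Re ((plane_part a b (\<sigma> x))\<^sup>2) * Re ((plane_part a b (\<sigma> y))\<^sup>2)"

definition im_corr :: "'n \<Rightarrow> 'n \<Rightarrow> 'a \<Rightarrow> 'a \<Rightarrow> ('a \<Rightarrow> real^'n) \<Rightarrow> real" where
  "im_corr a b x y \<sigma> = Im ((plane_part a b (\<sigma> x))\<^sup>2) * Im ((plane_part a b (\<sigma> y))\<^sup>2)"

lemma sum_component_squares: "norm (v :: real^'n) = 1 \<Longrightarrow> (\<Sum>a\<in>UNIV. (v $ a)\<^sup>2) = 1"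
  by (simp add: norm_vec_def L2_set_def)

text \<open>Each coordinate lies in \<open>2 * (N - 1)\<close> ordered pairs.\<close>

lemma sum_plane_corr_1:
  fixes \<sigma> :: "'a \<Rightarrow> real^'n"
  shows "(\<Sum>p | fst p \<noteq> snd p. plane_corr (fst p) (snd p) 1 x y \<sigma>) = 2 * (real CARD('n) - 1) * (\<sigma> x \<bullet> \<sigma> y)"
proof -
  have e: "plane_corr a b 1 x y \<sigma> = \<sigma> x $ a * \<sigma> y $ a + \<sigma> x $ b * \<sigma> y $ b" for a b
    by (simp add: plane_corr_def plane_part_def)
  show ?thesis
    unfolding e sum_distinct_pairs[of "\<lambda>a b. \<sigma> x $ a * \<sigma> y $ a + \<sigma> x $ b * \<sigma> y $ b"]
    by (simp add: sum.distrib inner_vec_def sum_sum_left algebra_simps flip: sum_distrib_left)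
qed

text \<open>Products of planar lengths have no closed sum. The arithmetic-geometric mean inequality
  replaces them by squared components, and the result matches the factor of the vector
  correlation.\<close>

lemma sum_plane_size_1_le:
  fixes \<sigma> :: "'a \<Rightarrow> real^'n"
  assumes "norm (\<sigma> x) = 1" "norm (\<sigma> y) = 1"
  shows "(\<Sum>p | fst p \<noteq> snd p. plane_size (fst p) (snd p) 1 x y \<sigma>) \<le> 2 * (real CARD('n) - 1)"
proof -
  have "plane_size a b 1 x y \<sigma> \<le> ((\<sigma> x $ a)\<^sup>2 + (\<sigma> x $ b)\<^sup>2 + (\<sigma> y $ a)\<^sup>2 + (\<sigma> y $ b)\<^sup>2) / 2" for a b
    using sum_squares_bound[of "cmod (plane_part a b (\<sigma> x))" "cmod (plane_part a b (\<sigma> y))"]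
    by (simp add: plane_size_def cmod_power2 plane_part_def)
  then have "(\<Sum>p | fst p \<noteq> snd p. plane_size (fst p) (snd p) 1 x y \<sigma>)
    \<le> (\<Sum>p | fst p \<noteq> snd p. ((\<sigma> x $ fst p)\<^sup>2 + (\<sigma> x $ snd p)\<^sup>2 + (\<sigma> y $ fst p)\<^sup>2 + (\<sigma> y $ snd p)\<^sup>2) / 2)"
    by (intro sum_mono)
  also have "\<dots> = 2 * (real CARD('n) - 1)"
    unfolding sum_distinct_pairs[of "\<lambda>a b. ((\<sigma> x $ a)\<^sup>2 + (\<sigma> x $ b)\<^sup>2 + (\<sigma> y $ a)\<^sup>2 + (\<sigma> y $ b)\<^sup>2) / 2"]
    by (simp add: sum.distrib sum_sum_left sum_component_squares[OF assms(1)] sum_component_squares[OF assms(2)]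
        flip: sum_divide_distrib sum_distrib_left)
  finally show ?thesis .
qed

lemma plane_corr_2: "plane_corr a b 2 x y \<sigma> = re_corr a b x y \<sigma> + im_corr a b x y \<sigma>"
  by (simp add: plane_corr_def re_corr_def im_corr_def power_mult_distrib flip: complex_cnj_power)

text \<open>The terms with \<open>a = b\<close> vanish, and the mixed products of squares sum to
  products of squared norms, whence the \<open>- 2\<close>.\<close>

lemma sum_re_corr:
  fixes \<sigma> :: "'a \<Rightarrow> real^'n"
  assumes "norm (\<sigma> x) = 1" "norm (\<sigma> y) = 1"
  shows "(\<Sum>p | fst p \<noteq> snd p. re_corr (fst p) (snd p) x y \<sigma>) = 2 * real CARD('n) * diag_corr x y \<sigma> - 2"
proof -
  have e: "re_corr a b x y \<sigma> = (\<sigma> x $ a)\<^sup>2 * (\<sigma> y $ a)\<^sup>2 + (\<sigma> x $ b)\<^sup>2 * (\<sigma> y $ b)\<^sup>2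
      - (\<sigma> x $ a)\<^sup>2 * (\<sigma> y $ b)\<^sup>2 - (\<sigma> y $ a)\<^sup>2 * (\<sigma> x $ b)\<^sup>2" for a b
    by (simp add: re_corr_def plane_part_def power2_eq_square algebra_simps)
  show ?thesis
    unfolding e sum_distinct_pairs[of "\<lambda>a b. (\<sigma> x $ a)\<^sup>2 * (\<sigma> y $ a)\<^sup>2 + (\<sigma> x $ b)\<^sup>2 * (\<sigma> y $ b)\<^sup>2 - (\<sigma> x $ a)\<^sup>2 * (\<sigma> y $ b)\<^sup>2 - (\<sigma> y $ a)\<^sup>2 * (\<sigma> x $ b)\<^sup>2"]
    by (simp add: sum.distrib sum_subtractf sum_sum_left[of "\<lambda>a. (\<sigma> x $ a)\<^sup>2 * (\<sigma> y $ a)\<^sup>2"] sum_sum_mult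
        sum_component_squares[OF assms(1)] sum_component_squares[OF assms(2)] diag_corr_def flip: sum_distrib_left)
qed

lemma sum_im_corr:
  fixes \<sigma> :: "'a \<Rightarrow> real^'n"
  shows "(\<Sum>p | fst p \<noteq> snd p. im_corr (fst p) (snd p) x y \<sigma>) = 4 * ((\<sigma> x \<bullet> \<sigma> y)\<^sup>2 - diag_corr x y \<sigma>)"
proof -
  define s where "s = (\<lambda>a. \<sigma> x $ a * \<sigma> y $ a)"
  have e: "im_corr a b x y \<sigma> = 4 * (s a * s b)" for a b
    by (simp add: s_def im_corr_def plane_part_def power2_eq_square algebra_simps)
  have "(\<Sum>a\<in>UNIV. \<Sum>b\<in>UNIV. 4 * (s a * s b)) = 4 * (sum s UNIV * sum s UNIV)"
    unfolding sum_product by (simp only: sum_distrib_left)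
  moreover have "sum s UNIV = \<sigma> x \<bullet> \<sigma> y"
    by (simp add: s_def inner_vec_def)
  moreover have "(\<Sum>a\<in>UNIV. 4 * (s a * s a)) = 4 * diag_corr x y \<sigma>"
    by (simp add: s_def diag_corr_def sum_distrib_left power2_eq_square mult_ac)
  ultimately show ?thesis
    unfolding e sum_distinct_pairs[of "\<lambda>a b. 4 * (s a * s b)"] by (simp add: power2_eq_square)
qed

text \<open>At \<open>a = b\<close> the expanded square is
  \<open>4 * (\<sigma> x $ a)^2 * (\<sigma> y $ a)^2\<close>; taking away this diagonal turns
  \<open>2 * N\<close> into \<open>2 * (N - 2)\<close>, the source of \<open>N - 2\<close> in the
  theorem.\<close>

lemma sum_plane_size_2:
  fixes \<sigma> :: "'a \<Rightarrow> real^'n"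
  assumes "norm (\<sigma> x) = 1" "norm (\<sigma> y) = 1"
  shows "(\<Sum>p | fst p \<noteq> snd p. plane_size (fst p) (snd p) 2 x y \<sigma>) = 2 * (real CARD('n) - 2) * diag_corr x y \<sigma> + 2"
proof -
  have e: "plane_size a b 2 x y \<sigma> = (\<sigma> x $ a)\<^sup>2 * (\<sigma> y $ a)\<^sup>2 + (\<sigma> x $ b)\<^sup>2 * (\<sigma> y $ b)\<^sup>2
      + (\<sigma> x $ a)\<^sup>2 * (\<sigma> y $ b)\<^sup>2 + (\<sigma> y $ a)\<^sup>2 * (\<sigma> x $ b)\<^sup>2" for a b
    by (simp add: plane_size_def power_mult_distrib cmod_power2 plane_part_def algebra_simps)
  show ?thesis
    unfolding e sum_distinct_pairs[of "\<lambda>a b. (\<sigma> x $ a)\<^sup>2 * (\<sigma> y $ a)\<^sup>2 + (\<sigma> x $ b)\<^sup>2 * (\<sigma> y $ b)\<^sup>2 + (\<sigma> x $ a)\<^sup>2 * (\<sigma> y $ b)\<^sup>2 + (\<sigma> y $ a)\<^sup>2 * (\<sigma> x $ b)\<^sup>2"]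
    by (simp add: sum.distrib sum_sum_left[of "\<lambda>a. (\<sigma> x $ a)\<^sup>2 * (\<sigma> y $ a)\<^sup>2"] sum_sum_mult
        sum_component_squares[OF assms(1)] sum_component_squares[OF assms(2)] diag_corr_def left_diff_distrib mult.assoc flip: sum_distrib_left)
qed

section \<open>Equal expectations of the two halves of the tensor correlation\<close>

lemma
  assumes xy: "x \<in> \<Lambda>" "y \<in> \<Lambda>"
  shows measurable_re_corr: "re_corr a b x y \<in> borel_measurable (spins \<Lambda>)"
    and measurable_im_corr: "im_corr a b x y \<in> borel_measurable (spins \<Lambda>)"
proof -
  have c: "(\<lambda>z::complex. Re (z\<^sup>2)) \<in> borel_measurable borel" "(\<lambda>z::complex. Im (z\<^sup>2)) \<in> borel_measurable borel"
    by (intro borel_measurable_continuous_onI continuous_intros)+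
  show "re_corr a b x y \<in> borel_measurable (spins \<Lambda>)"
    unfolding re_corr_def[abs_def]
    by (rule borel_measurable_times[OF measurable_compose[OF measurable_plane_part[OF xy(1)] c(1)]
        measurable_compose[OF measurable_plane_part[OF xy(2)] c(1)]])
  show "im_corr a b x y \<in> borel_measurable (spins \<Lambda>)"
    unfolding im_corr_def[abs_def]
    by (rule borel_measurable_times[OF measurable_compose[OF measurable_plane_part[OF xy(1)] c(2)]
        measurable_compose[OF measurable_plane_part[OF xy(2)] c(2)]])
qed

lemma
  assumes \<Lambda>: "finite \<Lambda>" and ab: "a \<noteq> b" and xy: "x \<in> \<Lambda>" "y \<in> \<Lambda>"
  shows integrable_re_corr: "integrable (spins \<Lambda>) (\<lambda>\<sigma>. re_corr a b x y \<sigma> * exp (H_iso \<Lambda> J' K' \<sigma>))"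
    and integrable_im_corr: "integrable (spins \<Lambda>) (\<lambda>\<sigma>. im_corr a b x y \<sigma> * exp (H_iso \<Lambda> J' K' \<sigma>))"
proof -
  have b: "\<bar>re_corr a b x y \<sigma>\<bar> \<le> plane_size a b 2 x y \<sigma>" "\<bar>im_corr a b x y \<sigma>\<bar> \<le> plane_size a b 2 x y \<sigma>" for \<sigma>
    unfolding re_corr_def im_corr_def plane_size_def abs_mult power_mult_distrib norm_power[symmetric]
    by (intro mult_mono abs_Re_le_cmod abs_Im_le_cmod norm_ge_zero abs_ge_zero)+
  have s: "plane_size a b 2 x y \<sigma> \<le> 1" if "\<forall>x\<in>\<Lambda>. norm (\<sigma> x) = 1" for \<sigma>
    using plane_size_le_1[OF ab, of \<sigma> x y 2] that xy by simp
  show "integrable (spins \<Lambda>) (\<lambda>\<sigma>. re_corr a b x y \<sigma> * exp (H_iso \<Lambda> J' K' \<sigma>))"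
    by (rule integrable_spins[OF \<Lambda> measurable_re_corr[OF xy] order_trans[OF b(1) s]])
  show "integrable (spins \<Lambda>) (\<lambda>\<sigma>. im_corr a b x y \<sigma> * exp (H_iso \<Lambda> J' K' \<sigma>))"
    by (rule integrable_spins[OF \<Lambda> measurable_im_corr[OF xy] order_trans[OF b(2) s]])
qed

text \<open>Rotating every spin by \<open>\<pi>/4\<close> in the plane multiplies the squares of the planar parts by \<open>\<i>\<close>;
  this replaces the classification of the rotation invariant tensors of rank four.\<close>
lemma integral_re_corr_eq_im_corr:
  fixes a b :: "'n::finite"
  assumes \<Lambda>: "finite \<Lambda>" and ab: "a \<noteq> b" and xy: "x \<in> \<Lambda>" "y \<in> \<Lambda>"
  shows "(\<integral>\<sigma>. re_corr a b x y \<sigma> * exp (H_iso \<Lambda> J' K' \<sigma>) \<partial>spins \<Lambda>) = (\<integral>\<sigma>. im_corr a b x y \<sigma> * exp (H_iso \<Lambda> J' K' \<sigma>) \<partial>spins \<Lambda>)"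
proof -
  define \<theta> where "\<theta> = (\<lambda>x\<in>\<Lambda>. pi / 4)"
  have "\<theta> \<in> space (torus \<Lambda>)"
    by (simp add: \<theta>_def space_PiM space_restrict_space)
  then have m: "(\<lambda>\<sigma>. rotate_all \<Lambda> a b (\<theta>, \<sigma>)) \<in> measurable (spins \<Lambda>) (spins \<Lambda>)"
    by (rule measurable_compose[OF measurable_Pair1' measurable_rotate_all])
  \<comment> \<open>The same angle is used at every site, so all inner products are preserved and
    the energy, not only the measure, is invariant.\<close>
  have H: "H_iso \<Lambda> J' K' (rotate_all \<Lambda> a b (\<theta>, \<sigma>)) = H_iso \<Lambda> J' K' \<sigma>" for \<sigma> :: "'a \<Rightarrow> real^'n"
  proof -
    have "rotate_all \<Lambda> a b (\<theta>, \<sigma>) u \<bullet> rotate_all \<Lambda> a b (\<theta>, \<sigma>) v = \<sigma> u \<bullet> \<sigma> v" if "u \<in> \<Lambda>" "v \<in> \<Lambda>" for u v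
      using orthogonal_transformation_plane_rot[OF ab, of "pi / 4"] that
      by (simp add: rotate_all_def \<theta>_def orthogonal_transformation_def)
    then show ?thesis
      unfolding H_iso_def bond_sum_def case_prod_unfold by (intro arg_cong[where f="\<lambda>s. s / 2"] sum.cong refl) simp
  qed
  have sq: "(plane_part a b (rotate_all \<Lambda> a b (\<theta>, \<sigma>) u))\<^sup>2 = \<i> * (plane_part a b (\<sigma> u))\<^sup>2" if "u \<in> \<Lambda>" for u \<sigma>
    using that by (simp add: rotate_all_def \<theta>_def plane_part_rot[OF ab] power_mult_distrib Complex.DeMoivre)
  have c: "re_corr a b x y (rotate_all \<Lambda> a b (\<theta>, \<sigma>)) = im_corr a b x y \<sigma>" for \<sigma>
    unfolding re_corr_def im_corr_def sq[OF xy(1)] sq[OF xy(2)] by simp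
  have me: "(\<lambda>\<sigma>. re_corr a b x y \<sigma> * exp (H_iso \<Lambda> J' K' \<sigma>)) \<in> borel_measurable (spins \<Lambda>)"
    by (intro borel_measurable_times measurable_compose[OF measurable_H_iso borel_measurable_exp] measurable_re_corr xy)
  show ?thesis
    using integral_distr[OF m me] unfolding distr_rotate_all[OF \<Lambda> ab] H c .
qed

lemma integral_distinct_pairs:
  fixes F :: "'n::finite \<Rightarrow> 'n \<Rightarrow> 'b \<Rightarrow> real"
  assumes "\<And>a b. a \<noteq> b \<Longrightarrow> integrable M (\<lambda>\<sigma>. F a b \<sigma> * w \<sigma>)"
  shows "integrable M (\<lambda>\<sigma>. (\<Sum>p | fst p \<noteq> snd p. F (fst p) (snd p) \<sigma>) * w \<sigma>)"
    and "(\<integral>\<sigma>. (\<Sum>p | fst p \<noteq> snd p. F (fst p) (snd p) \<sigma>) * w \<sigma> \<partial>M) = (\<Sum>p | fst p \<noteq> snd p. \<integral>\<sigma>. F (fst p) (snd p) \<sigma> * w \<sigma> \<partial>M)"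
  unfolding sum_distrib_right using assms
  by (auto intro!: Bochner_Integration.integrable_sum Bochner_Integration.integral_sum)

text \<open>Nonnegativity comes from comparing the model with itself: a quantity that dominates its
  own modulus is nonnegative. Both bounds are used to control the denominator of the final
  estimate.\<close>

lemma expect_XY_cos_bounds:
  assumes \<Lambda>: "finite \<Lambda>" and xy: "x \<in> \<Lambda>" "y \<in> \<Lambda>"
    and J: "\<And>u v. u \<in> \<Lambda> \<Longrightarrow> v \<in> \<Lambda> \<Longrightarrow> u \<noteq> v \<Longrightarrow> 0 \<le> J {u,v}" and K: "\<And>u v. u \<in> \<Lambda> \<Longrightarrow> v \<in> \<Lambda> \<Longrightarrow> u \<noteq> v \<Longrightarrow> 0 \<le> K {u,v}"
  shows "0 \<le> expect_XY \<Lambda> J K (\<lambda>\<theta>. cos (real m * (\<theta> x - \<theta> y)))" "expect_XY \<Lambda> J K (\<lambda>\<theta>. cos (real m * (\<theta> x - \<theta> y))) \<le> 1"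
proof -
  let ?E = "XY_energy \<Lambda> (\<lambda>x y. J {x,y}) (\<lambda>x y. K {x,y})"
  let ?C = "\<integral>\<theta>. cos (real m * (\<theta> x - \<theta> y)) * exp (?E \<theta>) \<partial>torus \<Lambda>" and ?Z = "\<integral>\<theta>. exp (?E \<theta>) \<partial>torus \<Lambda>"
  note Z = XY_partition_pos[OF \<Lambda>, of "\<lambda>x y. J {x,y}" "\<lambda>x y. K {x,y}"]
  have "\<bar>?C\<bar> * ?Z \<le> ?C * ?Z"
    by (rule XY_comparison[OF \<Lambda> xy]) (simp_all add: J K)
  then have "0 \<le> ?C" using Z(2) by (simp add: mult_le_cancel_right)
  then show "0 \<le> expect_XY \<Lambda> J K (\<lambda>\<theta>. cos (real m * (\<theta> x - \<theta> y)))"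
    unfolding gibbs_expect_XY using Z(2) by simp
  have "\<bar>?C\<bar> \<le> (\<integral>\<theta>. \<bar>cos (real m * (\<theta> x - \<theta> y)) * exp (?E \<theta>)\<bar> \<partial>torus \<Lambda>)"
    by (rule integral_abs_bound)
  also have "\<dots> \<le> ?Z"
    by (rule integral_mono'[OF Z(1)]) (simp_all add: abs_mult mult_left_le_one_le)
  finally show "expect_XY \<Lambda> J K (\<lambda>\<theta>. cos (real m * (\<theta> x - \<theta> y))) \<le> 1"
    unfolding gibbs_expect_XY using Z(2) by simp
qed

lemma summed_plane_comparison:
  fixes \<Lambda> :: "'a set"
  assumes \<Lambda>: "finite \<Lambda>" and xy: "x \<in> \<Lambda>" "y \<in> \<Lambda>"
    and hJ: "\<And>u v. u \<in> \<Lambda> \<Longrightarrow> v \<in> \<Lambda> \<Longrightarrow> u \<noteq> v \<Longrightarrow>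
       (if \<bar>K' {u,v}\<bar> \<le> \<bar>J' {u,v}\<bar> then \<bar>J' {u,v}\<bar>
        else \<bar>K' {u,v}\<bar> / 4 * (1 + \<bar>J' {u,v}\<bar> / \<bar>K' {u,v}\<bar>)^2) \<le> J {u,v}"
    and hK: "\<And>u v. u \<in> \<Lambda> \<Longrightarrow> v \<in> \<Lambda> \<Longrightarrow> u \<noteq> v \<Longrightarrow> \<bar>K' {u,v}\<bar> / 4 \<le> K {u,v}"
  shows "\<bar>\<integral>\<sigma>. (\<Sum>p | fst p \<noteq> snd p. plane_corr (fst p) (snd p) m x y \<sigma>) * exp (H_iso \<Lambda> J' K' (\<sigma> :: 'a \<Rightarrow> real^'n)) \<partial>spins \<Lambda>\<bar>
    \<le> expect_XY \<Lambda> J K (\<lambda>\<theta>. cos (real m * (\<theta> x - \<theta> y)))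
      * (\<integral>\<sigma>. (\<Sum>p | fst p \<noteq> snd p. plane_size (fst p) (snd p) m x y \<sigma>) * exp (H_iso \<Lambda> J' K' (\<sigma> :: 'a \<Rightarrow> real^'n)) \<partial>spins \<Lambda>)"
proof -
  have c: "\<bar>\<integral>\<sigma>. plane_corr a b m x y \<sigma> * exp (H_iso \<Lambda> J' K' (\<sigma> :: 'a \<Rightarrow> real^'n)) \<partial>spins \<Lambda>\<bar>
      \<le> expect_XY \<Lambda> J K (\<lambda>\<theta>. cos (real m * (\<theta> x - \<theta> y))) * (\<integral>\<sigma>. plane_size a b m x y \<sigma> * exp (H_iso \<Lambda> J' K' \<sigma>) \<partial>spins \<Lambda>)"
    if "a \<noteq> b" for a b :: 'n
    by (rule plane_comparison[where J'=J' and K'=K' and J=J and K=K, OF \<Lambda> that xy hJ hK])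
  let ?w = "\<lambda>\<sigma> :: 'a \<Rightarrow> real^'n. exp (H_iso \<Lambda> J' K' \<sigma>)"
  have e: "(\<integral>\<sigma>. (\<Sum>p | fst p \<noteq> snd p. plane_corr (fst p) (snd p) m x y \<sigma>) * ?w \<sigma> \<partial>spins \<Lambda>)
      = (\<Sum>p | fst p \<noteq> snd p. \<integral>\<sigma>. plane_corr (fst p) (snd p) m x y \<sigma> * ?w \<sigma> \<partial>spins \<Lambda>)"
    "(\<integral>\<sigma>. (\<Sum>p | fst p \<noteq> snd p. plane_size (fst p) (snd p) m x y \<sigma>) * ?w \<sigma> \<partial>spins \<Lambda>)
      = (\<Sum>p | fst p \<noteq> snd p. \<integral>\<sigma>. plane_size (fst p) (snd p) m x y \<sigma> * ?w \<sigma> \<partial>spins \<Lambda>)"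
    by (rule integral_distinct_pairs(2), rule integrable_plane_corr[OF \<Lambda> _ xy] integrable_plane_size[OF \<Lambda> _ xy], assumption)+
  show ?thesis
    unfolding e sum_distrib_left by (rule order_trans[OF sum_abs sum_mono[OF c]]) simp
qed

text \<open>\<open>p\<close> is the mean of the squared inner product and \<open>Q\<close> that of
  \<open>diag_corr\<close>. The equation \<open>turn\<close> determines \<open>Q\<close> from
  \<open>p\<close>, so the comparison becomes an inequality for \<open>p\<close> alone.\<close>

lemma tensor_bound:
  fixes N p Q \<gamma> :: real
  assumes N: "2 \<le> N" and \<gamma>: "0 \<le> \<gamma>" "\<gamma> \<le> 1" and turn: "2 * N * Q - 2 = 4 * (p - Q)"
    and le: "(2 * N * Q - 2) + 4 * (p - Q) \<le> \<gamma> * (2 * (N - 2) * Q + 2)"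
  shows "p \<le> 1/N + (N - 1) * (N + 2) / (N * (2*N - (N - 2) * \<gamma>)) * \<gamma>"
    and "1/N + (N - 1) * (N + 2) / (N * (2*N - (N - 2) * \<gamma>)) * \<gamma> \<le> 1/N + (1 - 1/N) * \<gamma>"
proof -
  define D where "D = 2*N - (N - 2) * \<gamma>"
  have "(N - 2) * \<gamma> \<le> (N - 2) * 1"
    using N \<gamma> by (intro mult_left_mono) auto
  \<comment> \<open>Here \<open>\<gamma> \<le> 1\<close> enters. It makes the denominator positive,
    and the last inequality of the lemma is \<open>(N + 2) / D \<le> 1\<close> multiplied by
    nonnegative factors.\<close>
  then have D: "N + 2 \<le> D" by (simp add: D_def)
  have Q: "Q = (2 * p + 1) / (N + 2)"
    using turn N by (simp add: field_simps)
  have "Q * D \<le> 2 + \<gamma>"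
    using le unfolding turn[symmetric] D_def by (simp add: algebra_simps)
  then have "(2 * p + 1) * D \<le> (2 + \<gamma>) * (N + 2)"
    using N by (simp add: Q field_simps)
  then have pD: "p * D \<le> 2 + N * \<gamma>"
    by (simp add: D_def algebra_simps)
  \<comment> \<open>The factor \<open>N\<close> allows \<open>D\<close> to be split off the right
    side; after division this leaves \<open>1/N\<close>, the value of the bound at
    \<open>\<gamma> = 0\<close>.\<close>
  have "N * (p * D) \<le> N * (2 + N * \<gamma>)"
    using N pD by (intro mult_left_mono) auto
  also have "\<dots> = D + (N - 1) * (N + 2) * \<gamma>"
    by (simp add: D_def algebra_simps)
  finally have "p \<le> (D + (N - 1) * (N + 2) * \<gamma>) / (N * D)"
    using N D by (simp add: pos_le_divide_eq mult_ac)
  also have "\<dots> = 1/N + (N - 1) * (N + 2) / (N * D) * \<gamma>"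
    using N D by (simp add: add_divide_distrib)
  finally show "p \<le> 1/N + (N - 1) * (N + 2) / (N * (2*N - (N - 2) * \<gamma>)) * \<gamma>"
    by (simp add: D_def)
  have "(N - 1) * (N + 2) / (N * D) = (1 - 1/N) * ((N + 2) / D)"
    using N D by (simp add: field_simps)
  also have "\<dots> \<le> (1 - 1/N) * 1"
    using N D by (intro mult_left_mono) auto
  finally show "1/N + (N - 1) * (N + 2) / (N * (2*N - (N - 2) * \<gamma>)) * \<gamma> \<le> 1/N + (1 - 1/N) * \<gamma>"
    unfolding D_def using mult_right_mono \<gamma>(1) by fastforce
qed

theorem theoremC8:
  fixes \<Lambda> :: "'a set"
    and J' K' J K :: "'a set \<Rightarrow> real"
    and x y :: 'a
  assumes fin: "finite \<Lambda>"
    and N2: "CARD('n::finite) \<ge> 2"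
    and hJ: "\<And>u v. u \<in> \<Lambda> \<Longrightarrow> v \<in> \<Lambda> \<Longrightarrow> u \<noteq> v \<Longrightarrow>
       (if \<bar>K' {u,v}\<bar> \<le> \<bar>J' {u,v}\<bar> then \<bar>J' {u,v}\<bar>
        else \<bar>K' {u,v}\<bar> / 4 * (1 + \<bar>J' {u,v}\<bar> / \<bar>K' {u,v}\<bar>)^2) \<le> J {u,v}"
    and hK: "\<And>u v. u \<in> \<Lambda> \<Longrightarrow> v \<in> \<Lambda> \<Longrightarrow> u \<noteq> v \<Longrightarrow> \<bar>K' {u,v}\<bar> / 4 \<le> K {u,v}"
    and xy: "x \<in> \<Lambda>" "y \<in> \<Lambda>"
  shows "(\<bar>expect_N \<Lambda> J' K' (\<lambda>\<sigma>::'a \<Rightarrow> real^'n. \<sigma> x \<bullet> \<sigma> y)\<bar>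
           \<le> expect_XY \<Lambda> J K (\<lambda>\<theta>. cos (\<theta> x - \<theta> y)))
     \<and> (let N = real CARD('n); \<gamma> = expect_XY \<Lambda> J K (\<lambda>\<theta>. cos (2 * (\<theta> x - \<theta> y)));
             m = expect_N \<Lambda> J' K' (\<lambda>\<sigma>::'a \<Rightarrow> real^'n. (\<sigma> x \<bullet> \<sigma> y)^2)
         in 0 \<le> m
          \<and> m \<le> 1/N + (N - 1) * (N + 2) / (N * (2*N - (N - 2) * \<gamma>)) * \<gamma>
          \<and> 1/N + (N - 1) * (N + 2) / (N * (2*N - (N - 2) * \<gamma>)) * \<gamma> \<le> 1/N + (1 - 1/N) * \<gamma>)"
proof -
  interpret prob_space "spins \<Lambda> :: ('a \<Rightarrow> real^'n) measure" by (rule prob_space_spins)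
  define N where "N = real CARD('n)"
  have N: "2 \<le> N" using N2 by (simp add: N_def)
  define E where "E = (\<lambda>\<sigma>::'a \<Rightarrow> real^'n. exp (H_iso \<Lambda> J' K' \<sigma>))"
  define I where "I = (\<lambda>f::('a \<Rightarrow> real^'n) \<Rightarrow> real. \<integral>\<sigma>. f \<sigma> * E \<sigma> \<partial>spins \<Lambda>)"
  define Z where "Z = (\<integral>\<sigma>. E \<sigma> \<partial>spins \<Lambda>)"
  have Z: "0 < Z" unfolding Z_def E_def by (rule spins_partition_pos[OF fin])
  have expect: "expect_N \<Lambda> J' K' f = I f / Z" for f
    by (simp add: expect_N_def gibbs_expect_def I_def Z_def E_def)
  define \<gamma> where "\<gamma> = (\<lambda>m::nat. expect_XY \<Lambda> J K (\<lambda>\<theta>. cos (real m * (\<theta> x - \<theta> y))))"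
  have J0: "0 \<le> J {u,v}" if "u \<in> \<Lambda>" "v \<in> \<Lambda>" "u \<noteq> v" for u v
    by (rule order_trans[OF _ hJ[OF that]]) simp
  have K0: "0 \<le> K {u,v}" if "u \<in> \<Lambda>" "v \<in> \<Lambda>" "u \<noteq> v" for u v
    by (rule order_trans[OF _ hK[OF that]]) simp
  have \<gamma>: "0 \<le> \<gamma> m" "\<gamma> m \<le> 1" for m
    unfolding \<gamma>_def by (rule expect_XY_cos_bounds[where J=J and K=K, OF fin xy J0 K0]; assumption)+
  have E_eq: "exp (H_iso \<Lambda> J' K' \<sigma>) = E \<sigma>" for \<sigma>
    by (simp add: E_def)
  note int = integrable_spins[where J'=J' and K'=K' and 'n='n, OF fin, unfolded E_eq]
  \<comment> \<open>The sums over planes are evaluated for unit spins, hence agree with their closed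
    forms almost everywhere only.\<close>
  have cong: "I f = I g" if "f \<in> borel_measurable (spins \<Lambda>)" "g \<in> borel_measurable (spins \<Lambda>)"
    "\<And>\<sigma>. \<forall>x\<in>\<Lambda>. norm (\<sigma> x) = 1 \<Longrightarrow> f \<sigma> = g \<sigma>" for f g
    unfolding I_def
  proof (rule integral_cong_AE)
    have mE: "E \<in> borel_measurable (spins \<Lambda>)"
      unfolding E_def by (rule measurable_compose[OF measurable_H_iso borel_measurable_exp])
    show "(\<lambda>\<sigma>. f \<sigma> * E \<sigma>) \<in> borel_measurable (spins \<Lambda>)" "(\<lambda>\<sigma>. g \<sigma> * E \<sigma>) \<in> borel_measurable (spins \<Lambda>)"
      by (rule borel_measurable_times[OF that(1) mE] borel_measurable_times[OF that(2) mE])+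
    show "AE \<sigma> in spins \<Lambda>. f \<sigma> * E \<sigma> = g \<sigma> * E \<sigma>"
      using AE_spins_norm[OF fin] by eventually_elim (simp only: that(3))
  qed
  define s where "s = (\<lambda>\<sigma>::'a \<Rightarrow> real^'n. \<sigma> x \<bullet> \<sigma> y)"
  define q where "q = (diag_corr x y :: ('a \<Rightarrow> real^'n) \<Rightarrow> real)"
  have ms: "s \<in> borel_measurable (spins \<Lambda>)"
    unfolding s_def by (rule measurable_spin_inner[OF xy])
  have mq: "q \<in> borel_measurable (spins \<Lambda>)"
    unfolding q_def diag_corr_def[abs_def]
    by (intro borel_measurable_sum borel_measurable_times borel_measurable_power measurable_spin_component xy)
  have bs: "\<bar>s \<sigma>\<bar> \<le> 1" if "\<forall>x\<in>\<Lambda>. norm (\<sigma> x) = 1" for \<sigma>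
    unfolding s_def using that xy by (intro abs_inner_le_1) auto
  have bq: "\<bar>q \<sigma>\<bar> \<le> N" if "\<forall>x\<in>\<Lambda>. norm (\<sigma> x) = 1" for \<sigma>
  proof -
    have c: "(\<sigma> z $ a)\<^sup>2 \<le> 1" if "z \<in> \<Lambda>" for z a
      using component_le_norm_cart[of "\<sigma> z" a] \<open>\<forall>x\<in>\<Lambda>. norm (\<sigma> x) = 1\<close> that by (simp add: abs_square_le_1)
    have "q \<sigma> \<le> (\<Sum>a\<in>(UNIV :: 'n set). 1)"
      unfolding q_def diag_corr_def by (intro sum_mono mult_le_one c xy) simp_all
    moreover have "0 \<le> q \<sigma>"
      unfolding q_def diag_corr_def by (intro sum_nonneg mult_nonneg_nonneg) simp_all
    ultimately show ?thesis by (simp add: N_def)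
  qed
  have is1: "integrable (spins \<Lambda>) (\<lambda>\<sigma>. s \<sigma> * E \<sigma>)"
    by (rule int[OF ms bs])
  have is2: "integrable (spins \<Lambda>) (\<lambda>\<sigma>. (s \<sigma>)\<^sup>2 * E \<sigma>)"
    by (rule int[OF borel_measurable_power[OF ms], of _ 1]) (use bs in \<open>simp add: abs_square_le_1\<close>)
  have iq: "integrable (spins \<Lambda>) (\<lambda>\<sigma>. q \<sigma> * E \<sigma>)"
    by (rule int[OF mq bq])
  have i1: "integrable (spins \<Lambda>) E"
    using int[of "\<lambda>_. 1" 1] by simp
  \<comment> \<open>Every \<open>m = 2\<close> sum over planes is a combination of \<open>q\<close>,
    the square of \<open>s\<close> and 1, so the tensor estimate involves only the two unknown
    moments of \<open>q\<close> and of the square of \<open>s\<close>.\<close>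
  have lin: "I (\<lambda>\<sigma>. \<alpha> * q \<sigma> + \<beta> * (s \<sigma>)\<^sup>2 + \<delta>) = \<alpha> * I q + \<beta> * I (\<lambda>\<sigma>. (s \<sigma>)\<^sup>2) + \<delta> * Z" for \<alpha> \<beta> \<delta>
    using is2 iq i1 by (simp add: I_def Z_def distrib_right mult.assoc)
  have mlin: "(\<lambda>\<sigma>. \<alpha> * q \<sigma> + \<beta> * (s \<sigma>)\<^sup>2 + \<delta>) \<in> borel_measurable (spins \<Lambda>)" for \<alpha> \<beta> \<delta>
    by (intro borel_measurable_add borel_measurable_times borel_measurable_const borel_measurable_power ms mq)
  have msum: "(\<lambda>\<sigma>. \<Sum>p | fst p \<noteq> snd p. F (fst p) (snd p) \<sigma>) \<in> borel_measurable (spins \<Lambda>)"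
    if "\<And>a b. F a b \<in> borel_measurable (spins \<Lambda>)" for F :: "'n \<Rightarrow> 'n \<Rightarrow> ('a \<Rightarrow> real^'n) \<Rightarrow> real"
    by (intro borel_measurable_sum that)
  note compare = summed_plane_comparison[where J'=J' and K'=K' and J=J and K=K and 'n='n, OF fin xy hJ hK, unfolded E_eq]

  \<comment> \<open>For \<open>m = 1\<close> the combinatorial factors on both sides agree and
    cancel.\<close>
  have "2 * (N - 1) * \<bar>I s\<bar> = \<bar>I (\<lambda>\<sigma>. \<Sum>p | fst p \<noteq> snd p. plane_corr (fst p) (snd p) 1 x y \<sigma>)\<bar>"
    unfolding sum_plane_corr_1 N_def[symmetric] using N by (simp add: I_def s_def mult.assoc abs_mult)
  also have "\<dots> \<le> \<gamma> 1 * I (\<lambda>\<sigma>. \<Sum>p | fst p \<noteq> snd p. plane_size (fst p) (snd p) 1 x y \<sigma>)"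
    unfolding I_def \<gamma>_def by (rule compare)
  also have "\<dots> \<le> \<gamma> 1 * (\<integral>\<sigma>. 2 * (N - 1) * E \<sigma> \<partial>spins \<Lambda>)"
    unfolding I_def
  proof (intro mult_left_mono \<gamma>(1) integral_mono_AE)
    show "integrable (spins \<Lambda>) (\<lambda>\<sigma>. (\<Sum>p | fst p \<noteq> snd p. plane_size (fst p) (snd p) 1 x y (\<sigma> :: 'a \<Rightarrow> real^'n)) * E \<sigma>)"
      unfolding E_def by (rule integral_distinct_pairs(1), rule integrable_plane_size[OF fin _ xy], assumption)
    show "integrable (spins \<Lambda>) (\<lambda>\<sigma>. 2 * (N - 1) * E \<sigma>)"
      by (rule integrable_mult_right[OF i1])
    show "AE \<sigma> in spins \<Lambda>. (\<Sum>p | fst p \<noteq> snd p. plane_size (fst p) (snd p) 1 x y \<sigma>) * E \<sigma> \<le> 2 * (N - 1) * E \<sigma>"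
      using AE_spins_norm[OF fin]
    proof eventually_elim
      case (elim \<sigma>)
      show ?case
        unfolding N_def by (rule mult_right_mono[OF sum_plane_size_1_le]) (use elim xy in \<open>simp_all add: E_def\<close>)
    qed
  qed
  also have "\<dots> = 2 * (N - 1) * (\<gamma> 1 * Z)"
    by (simp add: Z_def)
  finally have "\<bar>I s\<bar> \<le> \<gamma> 1 * Z"
    using N by simp
  then have vector: "\<bar>I s / Z\<bar> \<le> \<gamma> 1"
    using Z by (simp add: pos_divide_le_eq)

  define Q where "Q = I q / Z"
  define M where "M = I (\<lambda>\<sigma>. (s \<sigma>)\<^sup>2) / Z"
  have IQ: "I q = Q * Z" and IM: "I (\<lambda>\<sigma>. (s \<sigma>)\<^sup>2) = M * Z"
    using Z by (simp_all add: Q_def M_def)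
  have re: "I (\<lambda>\<sigma>. \<Sum>p | fst p \<noteq> snd p. re_corr (fst p) (snd p) x y \<sigma>) = (2 * N * Q - 2) * Z"
    using lin[of "2 * N" 0 "- 2"] unfolding IQ
    by (subst cong[OF msum[OF measurable_re_corr[OF xy]] mlin[of "2 * N" 0 "- 2"]])
       (use xy in \<open>simp_all add: sum_re_corr N_def q_def algebra_simps\<close>)
  have im: "I (\<lambda>\<sigma>. \<Sum>p | fst p \<noteq> snd p. im_corr (fst p) (snd p) x y \<sigma>) = 4 * (M - Q) * Z"
    using lin[of "- 4" 4 0] unfolding IQ IM
    by (subst cong[OF msum[OF measurable_im_corr[OF xy]] mlin[of "- 4" 4 0]])
       (simp_all add: sum_im_corr s_def q_def algebra_simps)
  have size: "I (\<lambda>\<sigma>. \<Sum>p | fst p \<noteq> snd p. plane_size (fst p) (snd p) 2 x y \<sigma>) = (2 * (N - 2) * Q + 2) * Z"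
    using lin[of "2 * (N - 2)" 0 2] unfolding IQ
    by (subst cong[OF msum[OF measurable_plane_size[OF xy]] mlin[of "2 * (N - 2)" 0 2]])
       (use xy in \<open>simp_all add: sum_plane_size_2 N_def q_def algebra_simps\<close>)
  have corr: "I (\<lambda>\<sigma>. \<Sum>p | fst p \<noteq> snd p. plane_corr (fst p) (snd p) 2 x y \<sigma>) = (2 * N * Q - 2 + 4 * (M - Q)) * Z"
    using lin[of "2 * N - 4" 4 "- 2"] unfolding IQ IM
    by (subst cong[OF msum[OF measurable_plane_corr[OF xy]] mlin[of "2 * N - 4" 4 "- 2"]])
       (use xy in \<open>simp_all add: plane_corr_2 sum.distrib sum_re_corr sum_im_corr s_def N_def q_def algebra_simps\<close>)
  have "I (\<lambda>\<sigma>. \<Sum>p | fst p \<noteq> snd p. re_corr (fst p) (snd p) x y \<sigma>) = (\<Sum>p | fst p \<noteq> snd p. I (re_corr (fst p) (snd p) x y))"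
    unfolding I_def E_def by (rule integral_distinct_pairs(2), rule integrable_re_corr[OF fin _ xy], assumption)
  \<comment> \<open>The equality holds in each plane; its sum gives the relation
    \<open>(N + 2) * Q = 2 * M + 1\<close> that eliminates \<open>Q\<close>.\<close>
  also have "\<dots> = (\<Sum>p | fst p \<noteq> snd p. I (im_corr (fst p) (snd p) x y))"
    unfolding I_def E_def by (rule sum.cong[OF refl integral_re_corr_eq_im_corr[OF fin _ xy]]) simp
  also have "\<dots> = I (\<lambda>\<sigma>. \<Sum>p | fst p \<noteq> snd p. im_corr (fst p) (snd p) x y \<sigma>)"
    unfolding I_def E_def by (rule integral_distinct_pairs(2)[symmetric], rule integrable_im_corr[OF fin _ xy], assumption)
  finally have turn: "2 * N * Q - 2 = 4 * (M - Q)"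
    unfolding re im using Z by simp
  have "(2 * N * Q - 2 + 4 * (M - Q)) * Z \<le> \<gamma> 2 * ((2 * (N - 2) * Q + 2) * Z)"
    unfolding corr[symmetric] size[symmetric] unfolding I_def \<gamma>_def by (rule abs_le_D1[OF compare])
  then have "2 * N * Q - 2 + 4 * (M - Q) \<le> \<gamma> 2 * (2 * (N - 2) * Q + 2)"
    using Z unfolding mult.assoc[symmetric] by (rule mult_right_le_imp_le)
  note tensor = tensor_bound[OF N \<gamma> turn this]
  have "0 \<le> M"
    unfolding M_def I_def E_def using Z by (intro divide_nonneg_pos integral_nonneg) simp_all
  with vector tensor show ?thesis
    unfolding Let_def expect M_def \<gamma>_def s_def N_def by simp
qed

end
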